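(* Let $X$ be a complex manifold satisfying Cond A, and let $\Omega \Subset X$ be a relatively compact subdomain. Then $\Omega$ is a domain of holomorphy if and only if $\Omega$ is holomorphically convex.
   Context: Cond A: $X$ is a connected complex manifold of dimension $n$ and there is a global holomorphic frame $\omega=(\omega^1,\dots,\omega^n)$ of the holomorphic cotangent bundle of $X$ over $X$ such that $d\omega^j=0$ for $1\le j\le n$. $\mathcal{O}(\Omega)$ is the set of holomorphic functions on $\Omega$. For compact $K\Subset\Omega$, $\hat{K}_\Omega=\{x\in\Omega: |g(x)|\le\max_K|g|,\ \forall g\in\mathcal{O}(\Omega)\}$. $\Omega$ is holomorphically convex if $\hat{K}_\Omega\Subset\Omega$ for every compact $K\Subset\Omega$. A relatively compact subdomain $\Omega\Subset X$ is a domain of holomorphy if there is no point $b\in\partial\Omega$ for which there exist a connected neighborhood $U$ of $b$ in $X$ and a non-empty open subset $V\subset U\cap\Omega$ such that for every $f\in\mathcal{O}(\Omega)$ there is $g\in\mathcal{O}(U)$ with $f|_V=g|_V$. *)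

theory Defs
  imports "HOL-Analysis.Analysis"
begin

text \<open>
  Points of the manifold form a type \<open>'a\<close> (the manifold is \<open>UNIV\<close>), its dimension is \<open>CARD('n)\<close>,
  and its complex structure is given by an atlas. A chart is a pair of a domain \<open>U\<close> and a
  coordinate map \<open>\<phi>\<close>, of which only the values on \<open>U\<close> matter.
\<close>

type_synonym ('a, 'n) chart = "'a set \<times> ('a \<Rightarrow> complex ^ 'n)"

abbreviation chart_dom :: "('a, 'n) chart \<Rightarrow> 'a set" where
  "chart_dom c \<equiv> fst c"

abbreviation chart_map :: "('a, 'n) chart \<Rightarrow> 'a \<Rightarrow> complex ^ 'n" where
  "chart_map c \<equiv> snd c"

definition chart_inv :: "('a, 'n) chart \<Rightarrow> complex ^ 'n \<Rightarrow> 'a" where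
  "chart_inv c = inv_into (chart_dom c) (chart_map c)"

definition transition :: "('a, 'n) chart \<Rightarrow> ('a, 'n) chart \<Rightarrow> complex ^ 'n \<Rightarrow> complex ^ 'n" where
  "transition c c' = chart_map c' \<circ> chart_inv c"

definition complex_functional :: "(complex ^ 'n \<Rightarrow> complex) \<Rightarrow> bool" where
  "complex_functional L \<longleftrightarrow> Vector_Spaces.linear (*s) (*) L"

text \<open>Holomorphy in several variables: the (real) Frechet derivative exists and is complex
  linear. It is only used on open sets \<open>S\<close>.\<close>

definition holomorphic_several :: "(complex ^ 'n \<Rightarrow> complex) \<Rightarrow> (complex ^ 'n) set \<Rightarrow> bool" where
  "holomorphic_several f S \<longleftrightarrow>
     (\<forall>p\<in>S. \<exists>D. (f has_derivative D) (at p) \<and> complex_functional D)"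

definition is_chart :: "('a::topological_space, 'n::finite) chart \<Rightarrow> bool" where
  "is_chart c \<longleftrightarrow> open (chart_dom c) \<and> open (chart_map c ` chart_dom c) \<and>
     homeomorphism (chart_dom c) (chart_map c ` chart_dom c) (chart_map c) (chart_inv c)"

text \<open>The Hausdorff property and second countability are part of the type class of the points.\<close>

definition complex_manifold ::
    "('a::{t2_space,second_countable_topology}, 'n::finite) chart set \<Rightarrow> bool" where
  "complex_manifold A \<longleftrightarrow>
     (\<forall>c\<in>A. is_chart c) \<and> (\<Union>c\<in>A. chart_dom c) = UNIV \<and>
     (\<forall>c\<in>A. \<forall>c'\<in>A. \<forall>j. holomorphic_several (\<lambda>p. transition c c' p $ j)
                        (chart_map c ` (chart_dom c \<inter> chart_dom c')))"

text \<open>The set \<open>\<O>(\<Omega>)\<close> for open \<open>\<Omega>\<close>; values of its members outside \<open>\<Omega>\<close> are arbitrary.\<close>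

definition hol_funs :: "('a, 'n::finite) chart set \<Rightarrow> 'a set \<Rightarrow> ('a \<Rightarrow> complex) set" where
  "hol_funs A \<Omega> = {f. \<forall>c\<in>A. holomorphic_several (f \<circ> chart_inv c)
                              (chart_map c ` (chart_dom c \<inter> \<Omega>))}"

text \<open>
  A form \<open>\<omega>\<close> of type (1,0) is represented in charts: \<open>\<omega> c x v\<close> is the value of the covector
  \<open>\<omega>\<^sub>x\<close> at the tangent vector whose coordinates in the chart \<open>c\<close> are \<open>v\<close>. It is meaningful only for
  \<open>c\<close> in the atlas and \<open>x\<close> in the domain of \<open>c\<close>. The third condition is the transformation law
  of covectors between charts; the last one says that the coefficients are holomorphic.
\<close>

type_synonym ('a, 'n) form1 = "('a, 'n) chart \<Rightarrow> 'a \<Rightarrow> complex ^ 'n \<Rightarrow> complex"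

definition holomorphic_form1 ::
    "('a, 'n::finite) chart set \<Rightarrow> ('a, 'n) form1 \<Rightarrow> bool" where
  "holomorphic_form1 A \<omega> \<longleftrightarrow>
     (\<forall>c\<in>A. \<forall>x\<in>chart_dom c. complex_functional (\<omega> c x)) \<and>
     (\<forall>c\<in>A. \<forall>c'\<in>A. \<forall>x\<in>chart_dom c \<inter> chart_dom c'. \<forall>v.
        \<omega> c x v = \<omega> c' x (frechet_derivative (transition c c') (at (chart_map c x)) v)) \<and>
     (\<forall>c\<in>A. \<forall>v. holomorphic_several (\<lambda>p. \<omega> c (chart_inv c p) v)
                   (chart_map c ` chart_dom c))"

text \<open>The exterior derivative in a chart, \<open>d\<omega>(u,v) = u(\<omega>(v)) - v(\<omega>(u))\<close> for the vector fields
  with constant coordinates \<open>u\<close> and \<open>v\<close> (whose Lie bracket vanishes).\<close>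

definition ext_deriv ::
    "('a, 'n::finite) form1 \<Rightarrow> ('a, 'n) chart \<Rightarrow> 'a \<Rightarrow> complex ^ 'n \<Rightarrow> complex ^ 'n \<Rightarrow> complex" where
  "ext_deriv \<omega> c x u v =
     frechet_derivative (\<lambda>p. \<omega> c (chart_inv c p) v) (at (chart_map c x)) u -
     frechet_derivative (\<lambda>p. \<omega> c (chart_inv c p) u) (at (chart_map c x)) v"

definition closed_form1 :: "('a, 'n::finite) chart set \<Rightarrow> ('a, 'n) form1 \<Rightarrow> bool" where
  "closed_form1 A \<omega> \<longleftrightarrow> (\<forall>c\<in>A. \<forall>x\<in>chart_dom c. \<forall>u v. ext_deriv \<omega> c x u v = 0)"

text \<open>A global holomorphic frame of the holomorphic cotangent bundle: the values
  \<open>\<omega>\<^sup>j\<^sub>x\<close> form a basis of the space of complex covectors at every point \<open>x\<close>.\<close>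

definition holomorphic_coframe ::
    "('a, 'n::finite) chart set \<Rightarrow> ('n \<Rightarrow> ('a, 'n) form1) \<Rightarrow> bool" where
  "holomorphic_coframe A \<omega> \<longleftrightarrow>
     (\<forall>j. holomorphic_form1 A (\<omega> j)) \<and>
     (\<forall>c\<in>A. \<forall>x\<in>chart_dom c. \<forall>L. complex_functional L \<longrightarrow>
        (\<exists>!a :: complex ^ 'n. L = (\<lambda>v. \<Sum>j\<in>UNIV. a $ j * \<omega> j c x v)))"

definition cond_A ::
    "('a::{t2_space,second_countable_topology}, 'n::finite) chart set \<Rightarrow> bool" where
  "cond_A A \<longleftrightarrow> complex_manifold A \<and> connected (UNIV :: 'a set) \<and>
     (\<exists>\<omega>. holomorphic_coframe A \<omega> \<and> (\<forall>j. closed_form1 A (\<omega> j)))"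

definition relatively_compact_in :: "'a::topological_space set \<Rightarrow> 'a set \<Rightarrow> bool" where
  "relatively_compact_in S T \<longleftrightarrow> compact (closure S) \<and> closure S \<subseteq> T"

definition subdomain :: "'a::topological_space set \<Rightarrow> bool" where
  "subdomain \<Omega> \<longleftrightarrow> open \<Omega> \<and> connected \<Omega> \<and> \<Omega> \<noteq> {}"

text \<open>The supremum is a maximum for nonempty compact \<open>K \<subseteq> \<Omega>\<close>.\<close>

definition hol_hull :: "('a, 'n::finite) chart set \<Rightarrow> 'a set \<Rightarrow> 'a set \<Rightarrow> 'a set" where
  "hol_hull A \<Omega> K = {x\<in>\<Omega>. \<forall>g\<in>hol_funs A \<Omega>. cmod (g x) \<le> (SUP y\<in>K. cmod (g y))}"

text \<open>The empty \<open>K\<close> is left out, since the supremum over it is an unspecified real number; its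
  hull is empty by convention.\<close>

definition holomorphically_convex ::
    "('a::topological_space, 'n::finite) chart set \<Rightarrow> 'a set \<Rightarrow> bool" where
  "holomorphically_convex A \<Omega> \<longleftrightarrow>
     (\<forall>K. compact K \<and> K \<subseteq> \<Omega> \<and> K \<noteq> {} \<longrightarrow> relatively_compact_in (hol_hull A \<Omega> K) \<Omega>)"

definition domain_of_holomorphy ::
    "('a::topological_space, 'n::finite) chart set \<Rightarrow> 'a set \<Rightarrow> bool" where
  "domain_of_holomorphy A \<Omega> \<longleftrightarrow>
     \<not> (\<exists>b\<in>frontier \<Omega>. \<exists>U V.
          open U \<and> connected U \<and> b \<in> U \<and>
          open V \<and> V \<noteq> {} \<and> V \<subseteq> U \<inter> \<Omega> \<and>
          (\<forall>f\<in>hol_funs A \<Omega>. \<exists>g\<in>hol_funs A U. \<forall>x\<in>V. f x = g x))"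

end

theory Submission
  imports Defs "HOL-Complex_Analysis.Complex_Analysis"
begin

text \<open>
  Local primitives of the closed coframe are, by the Poincare lemma and the inverse function
  theorem, charts of the same complex structure whose transitions have derivative the identity.
  Hence the derivative \<open>\<partial>\<^sub>v\<close> in a constant direction \<open>v\<close> of these charts is a well-defined operator on
  \<open>\<O>(\<Omega>)\<close>, and since the closure of \<open>\<Omega>\<close> is compact, all its points have coordinate balls of a
  common radius.

  If \<open>\<Omega>\<close> is a domain of holomorphy and \<open>x\<close> lies in the hull of \<open>K\<close>, the Cauchy estimates for
  \<open>\<partial>\<^sub>v\<^sup>k f\<close> on \<open>K\<close> pass to \<open>x\<close>, so the Taylor series at \<open>x\<close> of every \<open>f\<close> converges in a ball of radius
  independent of \<open>x\<close> and \<open>f\<close>. This ball therefore lies in \<open>\<Omega>\<close>, and the hull stays away from the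
  boundary. This is the argument of Cartan and Thullen.

  Conversely, suppose that every \<open>f\<close> extends from \<open>V\<close> to \<open>U\<close>. The component \<open>W\<close> of \<open>U \<inter> \<Omega>\<close> that meets
  \<open>V\<close> has a boundary point in \<open>U\<close> outside \<open>\<Omega>\<close>. Holomorphic convexity yields, as a series of peaks, a
  function in \<open>\<O>(\<Omega>)\<close> that is unbounded along a sequence in \<open>W\<close> tending to this point, while its
  extension is bounded there.
\<close>

section \<open>Holomorphic functions of several variables\<close>

text \<open>The hull inequality speaks only about functions holomorphic on all of \<Omega>, so a
  Cauchy estimate can travel from \<open>K\<close> to a hull point only if every derivative of
  \<open>f\<close> is again such a function. This is what the closed coframe buys: coordinates that
  are locally unique up to translation, hence globally defined derivatives in constant directions.
  Working with all directions of a given norm means that one complex line at a time suffices for the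
  estimates, and the balls so controlled are Euclidean balls of the same radius at the points of
  \<open>K\<close> and at the hull points. Both properties in the theorem see the atlas only through
  the functions holomorphic on open sets, which is why the given atlas may be exchanged for the
  adapted one.\<close>

lemma complex_functional_iff:
  "complex_functional L \<longleftrightarrow> (\<forall>u v. L (u + v) = L u + L v) \<and> (\<forall>c u. L (c *s u) = c * L u)"
  unfolding complex_functional_def Vector_Spaces.linear_def module_hom_def module_hom_axioms_def
    module_iff_vector_space
  by (simp add: vec.vector_space_axioms vector_space_over_itself.vector_space_axioms)

lemma complex_functional_add: "complex_functional L \<Longrightarrow> L (u + v) = L u + L v"
  and complex_functional_smult: "complex_functional L \<Longrightarrow> L (c *s u) = c * L u"
  by (auto simp: complex_functional_iff)

lemma complex_functional_zero: "complex_functional L \<Longrightarrow> L 0 = 0"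
  using complex_functional_smult[of L 0 0] by simp

lemma complex_functional_sum:
  assumes "complex_functional L" "finite I"
  shows "L (\<Sum>i\<in>I. f i) = (\<Sum>i\<in>I. L (f i))"
  using assms(2) by (induction I) (auto simp: complex_functional_add complex_functional_zero assms(1))

lemma complex_functional_expansion:
  fixes v :: "complex ^ 'n::finite"
  assumes "complex_functional L"
  shows "L v = (\<Sum>j\<in>UNIV. v $ j * L (axis j 1))"
proof -
  have "L v = L (\<Sum>j\<in>UNIV. (v $ j) *s axis j 1)"
    by (simp add: basis_expansion)
  also have "\<dots> = (\<Sum>j\<in>UNIV. v $ j * L (axis j 1))"
    by (simp add: complex_functional_sum complex_functional_smult assms)
  finally show ?thesis .
qed

lemma smult_of_real: "(complex_of_real r) *s v = r *\<^sub>R v"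
  by (simp add: vec_eq_iff scaleR_conv_of_real[symmetric])

lemma norm_smult: "norm (c *s (v::complex ^ 'n::finite)) = cmod c * norm v"
  by (simp add: norm_vec_def norm_mult L2_set_right_distrib)

lemma bounded_linear_smult_left: "bounded_linear (\<lambda>t. t *s (v::complex ^ 'n::finite))"
proof (rule bounded_linear_intro[where K = "norm v"])
  show "(x + y) *s v = x *s v + y *s v" for x y by (simp add: vec_eq_iff algebra_simps)
  show "(r *\<^sub>R x) *s v = r *\<^sub>R (x *s v)" for r x by (simp add: vec_eq_iff)
qed (simp add: norm_smult)

lemma bounded_linear_smult_right: "bounded_linear (\<lambda>v. c *s (v::complex ^ 'n::finite))"
proof (rule bounded_linear_intro[where K = "cmod c"])
  show "c *s (x + y) = c *s x + c *s y" for x y :: "complex^'n" 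
    by (simp add: vec_eq_iff algebra_simps)
  show "c *s (r *\<^sub>R x) = r *\<^sub>R (c *s x)" for r and x :: "complex^'n" by (simp add: vec_eq_iff)
qed (simp add: norm_smult)

lemmas continuous_on_smult_left [continuous_intros] =
  bounded_linear.continuous_on[OF bounded_linear_smult_left]

text \<open>The direction comes first so that \<open>dir_deriv v\<close> is an operator on
  functions, ready to be iterated with \<open>^^\<close>.\<close>

definition dir_deriv :: "complex ^ 'n::finite \<Rightarrow> (complex ^ 'n \<Rightarrow> complex) \<Rightarrow> complex ^ 'n \<Rightarrow> complex"
  where "dir_deriv v f p = frechet_derivative f (at p) v"

lemma holomorphic_several_has_derivative:
  assumes "holomorphic_several f S" "p \<in> S"
  shows "(f has_derivative (\<lambda>v. dir_deriv v f p)) (at p)"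
    and "complex_functional (\<lambda>v. dir_deriv v f p)"
  using assms unfolding holomorphic_several_def dir_deriv_def
  by (metis frechet_derivative_at)+

lemma dir_deriv_eq: "(f has_derivative D) (at p) \<Longrightarrow> dir_deriv v f p = D v"
  unfolding dir_deriv_def by (metis frechet_derivative_at)

lemma holomorphic_severalI:
  assumes "\<And>p. p \<in> S \<Longrightarrow> (f has_derivative D p) (at p)" "\<And>p. p \<in> S \<Longrightarrow> complex_functional (D p)"
  shows "holomorphic_several f S"
  using assms unfolding holomorphic_several_def by blast

lemma holomorphic_several_subset:
  "holomorphic_several f S \<Longrightarrow> T \<subseteq> S \<Longrightarrow> holomorphic_several f T"
  unfolding holomorphic_several_def by blast

text \<open>\<open>T\<close> may be any set containing \<open>p\<close>, because
  \<open>holomorphic_several\<close> takes derivatives at the point in the full space and not within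
  the set.\<close>

lemma holomorphic_several_locally:
  assumes "\<And>p. p \<in> S \<Longrightarrow> \<exists>T. p \<in> T \<and> holomorphic_several f T"
  shows "holomorphic_several f S"
  using assms unfolding holomorphic_several_def by blast

lemma holomorphic_several_cong:
  assumes "holomorphic_several f S" "open S" "\<And>p. p \<in> S \<Longrightarrow> f p = g p"
  shows "holomorphic_several g S"
proof (rule holomorphic_severalI)
  fix p assume p: "p \<in> S"
  note f = holomorphic_several_has_derivative[OF assms(1) p]
  show "(g has_derivative (\<lambda>v. dir_deriv v f p)) (at p)"
    by (rule has_derivative_transform_within_open[OF f(1) assms(2) p assms(3)])
  show "complex_functional (\<lambda>v. dir_deriv v f p)" by (rule f(2))
qed

lemma dir_deriv_cong:
  assumes "holomorphic_several f S" "open S" "\<And>p. p \<in> S \<Longrightarrow> f p = g p" "p \<in> S"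
  shows "dir_deriv v g p = dir_deriv v f p"
  by (intro dir_deriv_eq has_derivative_transform_within_open
      [OF holomorphic_several_has_derivative(1)[OF assms(1,4)] assms(2,4,3)])

lemma holomorphic_several_continuous_on:
  assumes "holomorphic_several f S" shows "continuous_on S f"
  using has_derivative_continuous[OF holomorphic_several_has_derivative(1)[OF assms]]
  by (intro continuous_at_imp_continuous_on) blast

lemma holomorphic_several_const: "holomorphic_several (\<lambda>_. c) S"
  by (rule holomorphic_severalI[where D = "\<lambda>_ _. 0"]) (auto simp: complex_functional_iff)

lemma holomorphic_several_nth: "holomorphic_several (\<lambda>z. z $ j) S"
  by (rule holomorphic_severalI[where D = "\<lambda>_ z. z $ j"])
     (auto simp: complex_functional_iff bounded_linear_vec_nth intro!: bounded_linear_imp_has_derivative)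

lemma holomorphic_several_add:
  assumes "holomorphic_several f S" "holomorphic_several g S"
  shows "holomorphic_several (\<lambda>z. f z + g z) S"
proof (rule holomorphic_severalI)
  fix p assume p: "p \<in> S"
  note f = holomorphic_several_has_derivative[OF assms(1) p]
  note g = holomorphic_several_has_derivative[OF assms(2) p]
  show "((\<lambda>z. f z + g z) has_derivative (\<lambda>v. dir_deriv v f p + dir_deriv v g p)) (at p)"
    by (rule has_derivative_add[OF f(1) g(1)])
  show "complex_functional (\<lambda>v. dir_deriv v f p + dir_deriv v g p)"
    using f(2) g(2) by (simp add: complex_functional_iff algebra_simps)
qed

lemma holomorphic_several_mult:
  assumes "holomorphic_several f S" "holomorphic_several g S"
  shows "holomorphic_several (\<lambda>z. f z * g z) S"
proof (rule holomorphic_severalI)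
  fix p assume p: "p \<in> S"
  note f = holomorphic_several_has_derivative[OF assms(1) p]
  note g = holomorphic_several_has_derivative[OF assms(2) p]
  show "((\<lambda>z. f z * g z) has_derivative (\<lambda>v. f p * dir_deriv v g p + dir_deriv v f p * g p)) (at p)"
    by (rule has_derivative_mult[OF f(1) g(1)])
  show "complex_functional (\<lambda>v. f p * dir_deriv v g p + dir_deriv v f p * g p)"
    using f(2) g(2) by (simp add: complex_functional_iff algebra_simps)
qed

lemma holomorphic_several_cmult:
  "holomorphic_several f S \<Longrightarrow> holomorphic_several (\<lambda>z. c * f z) S"
  by (intro holomorphic_several_mult holomorphic_several_const)

lemma holomorphic_several_diff:
  assumes "holomorphic_several f S" "holomorphic_several g S"
  shows "holomorphic_several (\<lambda>z. f z - g z) S"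
  using holomorphic_several_add[OF assms(1) holomorphic_several_cmult[OF assms(2), of "-1"]] by simp

lemma holomorphic_several_power:
  "holomorphic_several f S \<Longrightarrow> holomorphic_several (\<lambda>z. f z ^ k) S"
  by (induction k) (auto intro: holomorphic_several_mult holomorphic_several_const)

lemma holomorphic_several_sum:
  "(\<And>i. i \<in> I \<Longrightarrow> holomorphic_several (f i) S) \<Longrightarrow> holomorphic_several (\<lambda>z. \<Sum>i\<in>I. f i z) S"
  by (induction I rule: infinite_finite_induct)
     (auto intro: holomorphic_several_add holomorphic_several_const)

section \<open>Vector-valued maps, composition and translation\<close>

lemma has_derivative_vec:
  fixes F :: "'b::real_normed_vector \<Rightarrow> complex ^ 'n::finite"
  assumes "\<And>j. ((\<lambda>p. F p $ j) has_derivative (\<lambda>v. D v $ j)) (at p)"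
  shows "(F has_derivative D) (at p)"
proof -
  have "((\<lambda>p. \<Sum>j\<in>UNIV. (F p $ j) *s axis j 1) has_derivative
         (\<lambda>v. \<Sum>j\<in>UNIV. (D v $ j) *s axis j (1::complex))) (at p)"
    by (intro has_derivative_sum bounded_linear.has_derivative[OF bounded_linear_smult_left] assms)
  then show ?thesis by (simp add: basis_expansion)
qed

lemma has_derivative_vec_holomorphic:
  fixes F :: "complex ^ 'm::finite \<Rightarrow> complex ^ 'n::finite"
  assumes "\<And>j. holomorphic_several (\<lambda>p. F p $ j) S" "p \<in> S"
  shows "(F has_derivative (\<lambda>v. \<chi> j. dir_deriv v (\<lambda>p. F p $ j) p)) (at p)"
  by (rule has_derivative_vec) (simp add: holomorphic_several_has_derivative(1)[OF assms])

lemma holomorphic_several_compose: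
  fixes F :: "complex ^ 'm::finite \<Rightarrow> complex ^ 'n::finite"
  assumes "holomorphic_several f T" "\<And>j. holomorphic_several (\<lambda>p. F p $ j) S" "F ` S \<subseteq> T"
  shows "holomorphic_several (f \<circ> F) S"
proof (rule holomorphic_severalI)
  fix p assume p: "p \<in> S"
  let ?D = "\<lambda>v. \<chi> j. dir_deriv v (\<lambda>p. F p $ j) p"
  have Fp: "F p \<in> T" using p assms(3) by auto
  note f = holomorphic_several_has_derivative[OF assms(1) Fp]
  show "((f \<circ> F) has_derivative ((\<lambda>v. dir_deriv v f (F p)) \<circ> ?D)) (at p)"
    by (rule diff_chain_at[OF has_derivative_vec_holomorphic[OF assms(2) p] f(1)])
  have "?D (u + v) = ?D u + ?D v" "?D (c *s u) = c *s ?D u" for u v c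
    using holomorphic_several_has_derivative(2)[OF assms(2) p]
    by (simp_all add: vec_eq_iff complex_functional_iff)
  then show "complex_functional ((\<lambda>v. dir_deriv v f (F p)) \<circ> ?D)"
    using f(2) by (simp add: complex_functional_iff)
qed

lemma holomorphic_several_translate:
  assumes "holomorphic_several f T" "(\<lambda>p. p + a) ` S \<subseteq> T"
  shows "holomorphic_several (\<lambda>p. f (p + a)) S"
proof -
  have "holomorphic_several (\<lambda>p. (p + a) $ j) S" for j
    using holomorphic_several_add[OF holomorphic_several_nth[of j] holomorphic_several_const[of "a $ j"]]
    by simp
  from holomorphic_several_compose[OF assms(1) this assms(2)] show ?thesis by (simp add: o_def)
qed

subsection \<open>Restriction to complex lines\<close>

text \<open>The bridge to one variable: complex linearity of the Frechet derivative turns the real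
  derivative along the line into multiplication by one complex number.\<close>

lemma line_deriv:
  assumes "holomorphic_several f S" "p + t *s v \<in> S"
  shows "((\<lambda>t. f (p + t *s v)) has_field_derivative dir_deriv v f (p + t *s v)) (at t)"
proof -
  have "((\<lambda>t. p + t *s v) has_derivative (\<lambda>s. 0 + s *s v)) (at t)"
    by (intro has_derivative_add has_derivative_const bounded_linear_imp_has_derivative
        bounded_linear_smult_left)
  from diff_chain_at[OF this holomorphic_several_has_derivative(1)[OF assms]]
  have "((\<lambda>t. f (p + t *s v)) has_derivative (\<lambda>s. dir_deriv (s *s v) f (p + t *s v))) (at t)"
    by (simp add: o_def)
  moreover have "(\<lambda>s. dir_deriv (s *s v) f (p + t *s v)) = (*) (dir_deriv v f (p + t *s v))"
    using complex_functional_smult[OF holomorphic_several_has_derivative(2)[OF assms]]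
    by (auto simp: mult.commute)
  ultimately show ?thesis by (simp add: has_field_derivative_def)
qed

lemma holomorphic_on_line:
  assumes "holomorphic_several f S" "\<And>t. t \<in> T \<Longrightarrow> p + t *s v \<in> S"
  shows "(\<lambda>t. f (p + t *s v)) holomorphic_on T"
  using line_deriv[OF assms(1) assms(2)] unfolding holomorphic_on_def
  by (meson DERIV_subset field_differentiable_def subset_UNIV)

lemma open_line_preimage:
  fixes S :: "(complex ^ 'n::finite) set"
  shows "open S \<Longrightarrow> open {t. p + t *s v \<in> S}"
  using open_vimage[of S "\<lambda>t. p + t *s v"] by (simp add: vimage_def continuous_intros)

text \<open>Cauchy's inequality on the disc of radius \<open>R\<close> in the line through
  \<open>p\<close> in direction \<open>v\<close>; the condition on \<open>R * norm v\<close> keeps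
  this disc in the ball where \<open>M\<close> bounds \<open>f\<close>.\<close>

lemma line_Cauchy_bound:
  assumes "holomorphic_several f S" "cball p \<rho> \<subseteq> S" "R > 0" "R * norm v \<le> \<rho>"
    and "\<And>q. q \<in> cball p \<rho> \<Longrightarrow> cmod (f q) \<le> M"
  shows "cmod ((deriv ^^ k) (\<lambda>t. f (p + t *s v)) 0) \<le> fact k * M / R ^ k"
proof -
  have in_ball: "p + t *s v \<in> cball p \<rho>" if "t \<in> cball 0 R" for t
  proof -
    have "cmod t * norm v \<le> R * norm v" using that by (intro mult_right_mono) auto
    then show ?thesis using assms(4) by (simp add: dist_norm norm_smult)
  qed
  have hol: "(\<lambda>t. f (p + t *s v)) holomorphic_on cball 0 R"
    by (rule holomorphic_on_line[OF assms(1)]) (use in_ball assms(2) in blast)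
  show ?thesis
  proof (rule Cauchy_inequality)
    show "(\<lambda>t. f (p + t *s v)) holomorphic_on ball 0 R"
      using hol by (rule holomorphic_on_subset) auto
    show "cmod (f (p + t *s v)) \<le> M" if "cmod (0 - t) = R" for t
      using assms(5) in_ball that by simp
  qed (use hol holomorphic_on_imp_continuous_on assms(3) in auto)
qed

lemma dir_deriv_bound:
  assumes "holomorphic_several f S" "cball p \<rho> \<subseteq> S" "\<rho> > 0"
    and "\<And>q. q \<in> cball p \<rho> \<Longrightarrow> cmod (f q) \<le> M"
  shows "cmod (dir_deriv v f p) \<le> M / \<rho> * norm v"
proof (cases "v = 0")
  case True
  have "p \<in> S" using assms(2,3) by auto
  from complex_functional_zero[OF holomorphic_several_has_derivative(2)[OF assms(1) this]] True
  show ?thesis by simp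
next
  case False
  have "p \<in> S" using assms(2,3) by auto
  then have "deriv (\<lambda>t. f (p + t *s v)) 0 = dir_deriv v f p"
    using line_deriv[OF assms(1), of p 0 v] by (auto intro: DERIV_imp_deriv)
  \<comment> \<open>The largest disc of the line that fits in the ball has radius
    \<open>\<rho> / norm v\<close>, whence the separate case \<open>v = 0\<close>.\<close>
  with line_Cauchy_bound[OF assms(1,2) _ _ assms(4), of "\<rho> / norm v" v 1] False assms(3)
  show ?thesis by (simp add: field_simps)
qed

subsection \<open>Locally uniform limits\<close>

text \<open>The Cauchy estimate for \<open>f m - f n\<close> makes the derivatives uniformly Cauchy
  as operators, so the sequence may be differentiated term by term. Halving the radius leaves room
  for the balls of radius \<open>r/4\<close> of the estimate.\<close>

lemma holomorphic_several_uniform_limit_ball: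
  assumes hol: "\<And>n. holomorphic_several (f n) (ball p r)" and "r > 0"
    and lim: "uniform_limit (ball p r) f g sequentially"
  shows "holomorphic_several g (ball p (r/2))"
proof -
  let ?B = "ball p (r/2)"
  have sub: "cball x (r/4) \<subseteq> ball p r" if "x \<in> ?B" for x
  proof
    fix y assume "y \<in> cball x (r/4)"
    then show "y \<in> ball p r" using that \<open>r > 0\<close> dist_triangle[of p y x] by simp
  qed
  have in_ball: "x \<in> ball p r" if "x \<in> ?B" for x using that \<open>r > 0\<close> by simp
  have diff: "dir_deriv h (\<lambda>z. f m z - f n z) x = dir_deriv h (f m) x - dir_deriv h (f n) x"
    if "x \<in> ball p r" for m n h x
    using holomorphic_several_has_derivative(1)[OF hol that]
    by (intro dir_deriv_eq has_derivative_diff) auto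
  have Cau: "\<exists>N. \<forall>m\<ge>N. \<forall>n\<ge>N. \<forall>x\<in>?B. \<forall>h.
      cmod (dir_deriv h (f m) x - dir_deriv h (f n) x) \<le> e * norm h" if "e > 0" for e
  proof -
    have "uniformly_Cauchy_on (ball p r) f"
      using lim unfolding uniformly_convergent_eq_Cauchy[symmetric] uniformly_convergent_on_def
      by blast
    moreover have "e * (r/4) > 0" using \<open>e > 0\<close> \<open>r > 0\<close> by simp
    ultimately obtain N where
      N: "\<And>x m n. x \<in> ball p r \<Longrightarrow> m \<ge> N \<Longrightarrow> n \<ge> N \<Longrightarrow> dist (f m x) (f n x) < e * (r/4)"
      unfolding uniformly_Cauchy_on_def by blast
    have "cmod (dir_deriv h (f m) x - dir_deriv h (f n) x) \<le> e * norm h"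
      if "m \<ge> N" "n \<ge> N" "x \<in> ?B" for m n x h
    proof -
      have "cmod (dir_deriv h (\<lambda>z. f m z - f n z) x) \<le> e * (r/4) / (r/4) * norm h"
      proof (rule dir_deriv_bound[OF holomorphic_several_diff[OF hol hol] sub[OF that(3)]])
        show "cmod (f m q - f n q) \<le> e * (r/4)" if "q \<in> cball x (r/4)" for q
          using N[of q m n] that sub[OF \<open>x \<in> ?B\<close>] \<open>m \<ge> N\<close> \<open>n \<ge> N\<close>
          by (metis dist_norm less_eq_real_def subsetD)
      qed (use \<open>r > 0\<close> in auto)
      then show ?thesis using diff[OF in_ball[OF that(3)]] \<open>r > 0\<close> by simp
    qed
    then show ?thesis by blast
  qed
  have conv: "convergent (\<lambda>n. dir_deriv h0 (f n) x)" if "x \<in> ?B" for x h0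
  proof (intro Cauchy_convergent metric_CauchyI)
    fix e :: real assume "e > 0"
    then have "e / (norm h0 + 1) > 0" by (simp add: add_nonneg_pos)
    from Cau[OF this] obtain N where N: "\<And>m n x h. m \<ge> N \<Longrightarrow> n \<ge> N \<Longrightarrow> x \<in> ?B \<Longrightarrow>
        cmod (dir_deriv h (f m) x - dir_deriv h (f n) x) \<le> e / (norm h0 + 1) * norm h" by blast
    have "e / (norm h0 + 1) * norm h0 < e"
      using \<open>e > 0\<close> by (simp add: field_simps add_pos_nonneg)
    then have "dist (dir_deriv h0 (f m) x) (dir_deriv h0 (f n) x) < e" if "m \<ge> N" "n \<ge> N" for m n
      using N[OF that \<open>x \<in> ?B\<close>, of h0] by (simp add: dist_norm)
    then show "\<exists>N. \<forall>m\<ge>N. \<forall>n\<ge>N. dist (dir_deriv h0 (f m) x) (dir_deriv h0 (f n) x) < e"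
      by blast
  qed
  define g' where "g' x h = lim (\<lambda>n. dir_deriv h (f n) x)" for x h
  have g'_lim: "(\<lambda>n. dir_deriv h (f n) x) \<longlonglongrightarrow> g' x h" if "x \<in> ?B" for x h
    using conv[OF that] unfolding g'_def by (simp add: convergent_LIMSEQ_iff)
  have close: "\<forall>\<^sub>F n in sequentially. \<forall>x\<in>?B. \<forall>h.
      norm (dir_deriv h (f n) x - g' x h) \<le> e * norm h" if "e > 0" for e
  proof -
    from Cau[OF that] obtain N where N: "\<And>m n x h. m \<ge> N \<Longrightarrow> n \<ge> N \<Longrightarrow> x \<in> ?B \<Longrightarrow>
      cmod (dir_deriv h (f m) x - dir_deriv h (f n) x) \<le> e * norm h" by blast
    have "norm (dir_deriv h (f m) x - g' x h) \<le> e * norm h" if "m \<ge> N" "x \<in> ?B" for m x h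
    proof (rule LIMSEQ_le_const2)
      show "(\<lambda>n. norm (dir_deriv h (f m) x - dir_deriv h (f n) x))
          \<longlonglongrightarrow> norm (dir_deriv h (f m) x - g' x h)"
        by (intro tendsto_intros g'_lim that)
      show "\<exists>k. \<forall>n\<ge>k. norm (dir_deriv h (f m) x - dir_deriv h (f n) x) \<le> e * norm h"
        using N that by blast
    qed
    then show ?thesis unfolding eventually_sequentially by blast
  qed
  have g_lim: "(\<lambda>n. f n x) \<longlonglongrightarrow> g x" if "x \<in> ?B" for x
    using tendsto_uniform_limitI[OF lim in_ball[OF that]] .
  have "\<exists>G. \<forall>x\<in>?B. (\<lambda>n. f n x) \<longlonglongrightarrow> G x \<and> (G has_derivative g' x) (at x within ?B)"
  proof (rule has_derivative_sequence[OF _ _ close])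
    show "(f n has_derivative (\<lambda>h. dir_deriv h (f n) x)) (at x within ?B)" if "x \<in> ?B" for n x
      using holomorphic_several_has_derivative(1)[OF hol in_ball[OF that]] has_derivative_at_withinI
      by blast
    show "p \<in> ?B" using \<open>r > 0\<close> by simp
    then show "(\<lambda>n. f n p) \<longlonglongrightarrow> g p" by (rule g_lim)
  qed auto
  then obtain G where G: "\<And>x. x \<in> ?B \<Longrightarrow> (\<lambda>n. f n x) \<longlonglongrightarrow> G x"
    "\<And>x. x \<in> ?B \<Longrightarrow> (G has_derivative g' x) (at x within ?B)" by blast
  have Gg: "G x = g x" if "x \<in> ?B" for x
    using G(1)[OF that] g_lim[OF that] LIMSEQ_unique by blast
  show ?thesis
  proof (rule holomorphic_severalI)
    fix x assume x: "x \<in> ?B"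
    have "(G has_derivative g' x) (at x)"
      using G(2)[OF x] x at_within_open[of x ?B] by simp
    then show "(g has_derivative g' x) (at x)"
      by (rule has_derivative_transform_within_open[OF _ open_ball x]) (use Gg in auto)
    have cf: "complex_functional (\<lambda>h. dir_deriv h (f n) x)" for n
      by (rule holomorphic_several_has_derivative(2)[OF hol in_ball[OF x]])
    have "g' x (u + v) = g' x u + g' x v" for u v
      using tendsto_add[OF g'_lim[OF x, of u] g'_lim[OF x, of v]] g'_lim[OF x, of "u + v"]
      by (simp add: complex_functional_add[OF cf] LIMSEQ_unique)
    moreover have "g' x (c *s u) = c * g' x u" for c u
      using tendsto_mult_left[OF g'_lim[OF x, of u], of c] g'_lim[OF x, of "c *s u"]
      by (simp add: complex_functional_smult[OF cf] LIMSEQ_unique)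
    ultimately show "complex_functional (g' x)" by (simp add: complex_functional_iff)
  qed
qed

lemma holomorphic_several_uniform_limit:
  assumes "\<And>n. holomorphic_several (f n) S"
    and "\<And>p. p \<in> S \<Longrightarrow> \<exists>r>0. ball p r \<subseteq> S \<and> uniform_limit (ball p r) f g sequentially"
  shows "holomorphic_several g S"
proof (rule holomorphic_several_locally)
  fix p assume "p \<in> S"
  from assms(2)[OF this] obtain r where r: "r > 0" "ball p r \<subseteq> S"
    "uniform_limit (ball p r) f g sequentially" by blast
  have "holomorphic_several g (ball p (r/2))"
    using holomorphic_several_subset[OF assms(1) r(2)] r
    by (intro holomorphic_several_uniform_limit_ball)
  then show "\<exists>T. p \<in> T \<and> holomorphic_several g T"
    using r(1) by (intro exI[of _ "ball p (r/2)"]) simp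
qed

subsection \<open>Iterated directional derivatives\<close>

text \<open>The directional derivative is a locally uniform limit of difference quotients, which are
  visibly holomorphic; the rate of convergence comes from a one-variable bound of the second
  derivative.\<close>

lemma holomorphic_several_dir_deriv:
  assumes "open S" and hol: "holomorphic_several f S"
  shows "holomorphic_several (dir_deriv v f) S"
proof (rule holomorphic_several_locally)
  fix p assume "p \<in> S"
  then obtain r where r: "r > 0" "cball p r \<subseteq> S"
    using \<open>open S\<close> open_contains_cball by blast
  have "bounded (f ` cball p r)"
    by (intro compact_imp_bounded compact_continuous_image compact_cball
        holomorphic_several_continuous_on[OF holomorphic_several_subset[OF hol r(2)]])
  then obtain M where M: "\<And>q. q \<in> cball p r \<Longrightarrow> cmod (f q) \<le> M"
    unfolding bounded_iff by (meson imageI)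
  \<comment> \<open>Parameters of modulus at most \<open>R\<close> move a point of the half ball by
    at most \<open>r/2\<close>; the added 1 covers \<open>v = 0\<close>.\<close>
  define R where "R = r / (2 * (norm v + 1))"
  have R: "R > 0" "R * norm v \<le> r / 2"
  proof -
    have "norm v + 1 > 0" by (simp add: add_nonneg_pos)
    then show "R > 0" "R * norm v \<le> r / 2" using r(1) by (simp_all add: R_def field_simps)
  qed
  have line: "q + t *s v \<in> ball p r" if "q \<in> ball p (r/2)" "cmod t \<le> R" for q t
  proof -
    have "norm (t *s v) \<le> r / 2"
      using mult_right_mono[OF that(2) norm_ge_zero[of v]] R(2) by (simp add: norm_smult)
    moreover have "dist p (q + t *s v) \<le> dist p q + norm (t *s v)"
      using dist_triangle[of p "q + t *s v" q] by (simp add: dist_norm)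
    ultimately show ?thesis using that(1) by simp
  qed
  \<comment> \<open>Cauchy's bound for the second derivative along the line at parameters of modulus
    at most \<open>R/2\<close>: around each of them a disc of radius \<open>R/2\<close> still lies
    in the disc of radius \<open>R\<close>.\<close>
  define B where "B = 2 * M / (R/2)^2"
  have quotient: "cmod ((f (q + t *s v) - f q) / t - dir_deriv v f q) \<le> B * cmod t"
    if q: "q \<in> ball p (r/2)" and t: "cmod t \<le> R/2" "t \<noteq> 0" for q t
  proof -
    let ?h = "\<lambda>t. f (q + t *s v)"
    let ?T = "{t. q + t *s v \<in> S}"
    have T: "open ?T" by (rule open_line_preimage[OF \<open>open S\<close>])
    have h: "?h holomorphic_on ?T" by (rule holomorphic_on_line[OF hol]) simp
    have ballT: "cball 0 R \<subseteq> ?T"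
    proof
      fix t assume "t \<in> cball (0::complex) R"
      then have "q + t *s v \<in> ball p r" by (intro line[OF q]) simp
      then show "t \<in> ?T" using r(2) ball_subset_cball by blast
    qed
    have "cmod ((deriv ^^ 0) ?h t - (\<Sum>i\<le>1. (deriv ^^ i) ?h 0 * (t - 0) ^ i / fact i))
        \<le> B * cmod (t - 0) ^ Suc 1 / fact 1"
    proof (rule complex_Taylor[where S = "cball 0 (R/2)"])
      fix i w assume "w \<in> cball (0::complex) (R/2)"
      then have "w \<in> ?T" using \<open>R > 0\<close> by (intro subsetD[OF ballT]) simp
      then have "((deriv ^^ i) ?h has_field_derivative deriv ((deriv ^^ i) ?h) w) (at w)"
        using holomorphic_derivI[OF holomorphic_higher_deriv[OF h T] T] by blast
      then show "((deriv ^^ i) ?h has_field_derivative (deriv ^^ Suc i) ?h w)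
          (at w within cball 0 (R/2))"
        by (simp add: has_field_derivative_at_within)
    next
      fix w assume w: "w \<in> cball (0::complex) (R/2)"
      have sub: "cball w (R/2) \<subseteq> cball 0 R"
      proof
        fix x assume "x \<in> cball w (R/2)"
        then show "x \<in> cball 0 R" using w dist_triangle[of 0 x w] by simp
      qed
      have "cmod ((deriv ^^ 2) ?h w) \<le> fact 2 * M / (R/2)^2"
      proof (rule Cauchy_inequality)
        show "?h holomorphic_on ball w (R/2)"
          using holomorphic_on_subset[OF h] sub ballT ball_subset_cball by blast
        show "continuous_on (cball w (R/2)) ?h"
          using holomorphic_on_imp_continuous_on[OF holomorphic_on_subset[OF h]] sub ballT by blast
        fix x assume "cmod (w - x) = R/2"
        then have "x \<in> cball 0 R" using sub by (auto simp: dist_norm)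
        then have "q + x *s v \<in> ball p r" using line[OF q] by simp
        then show "cmod (f (q + x *s v)) \<le> M" by (intro M) simp
      qed (use \<open>R > 0\<close> in simp)
      then show "cmod ((deriv ^^ Suc 1) ?h w) \<le> B" by (simp add: B_def numeral_2_eq_2)
    qed (use t \<open>R > 0\<close> in auto)
    moreover have "deriv ?h 0 = dir_deriv v f q"
      using line_deriv[OF hol, of q 0 v] subsetD[OF ballT, of 0] \<open>R > 0\<close>
      by (auto intro!: DERIV_imp_deriv)
    ultimately have "cmod (f (q + t *s v) - (f q + dir_deriv v f q * t)) \<le> B * cmod t ^ 2"
      by (simp add: numeral_2_eq_2)
    then have "cmod (f (q + t *s v) - (f q + dir_deriv v f q * t)) / cmod t \<le> B * cmod t"
      using t(2) by (simp add: field_simps power2_eq_square)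
    moreover have "(f (q + t *s v) - f q) / t - dir_deriv v f q
        = (f (q + t *s v) - (f q + dir_deriv v f q * t)) / t"
      using t(2) by (simp add: field_simps)
    ultimately show ?thesis by (simp add: norm_divide)
  qed
  \<comment> \<open>Any null sequence of nonzero parameters of modulus at most \<open>R/2\<close>
    would do.\<close>
  define t where "t k = complex_of_real (R / 2 / real (Suc k))" for k
  have cmod_t: "cmod (t k) = R / 2 / real (Suc k)" for k
    unfolding t_def norm_of_real using R(1) by simp
  have t: "cmod (t k) \<le> R/2" "t k \<noteq> 0" for k
  proof -
    show "cmod (t k) \<le> R/2" unfolding cmod_t using R(1) by (simp add: field_simps)
    have "cmod (t k) > 0" unfolding cmod_t using R(1) by simp
    then show "t k \<noteq> 0" by auto
  qed
  have t_lim: "(\<lambda>k. B * cmod (t k)) \<longlonglongrightarrow> 0"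
  proof -
    have "(\<lambda>k. B * (R / 2 * (1 / real (Suc k)))) \<longlonglongrightarrow> B * (R / 2 * 0)"
      by (intro tendsto_mult_left LIMSEQ_Suc[OF lim_1_over_n])
    then show ?thesis unfolding cmod_t by simp
  qed
  have "holomorphic_several (dir_deriv v f) (ball p (r/2/2))"
  proof (rule holomorphic_several_uniform_limit_ball)
    fix k
    have "holomorphic_several (\<lambda>q. f (q + t k *s v)) (ball p (r/2))"
    proof (rule holomorphic_several_translate[OF hol])
      have "cmod (t k) \<le> R" using t(1)[of k] R(1) by simp
      then show "(\<lambda>q. q + t k *s v) ` ball p (r/2) \<subseteq> S"
        using line r(2) ball_subset_cball by blast
    qed
    moreover have "holomorphic_several f (ball p (r/2))"
      using hol r by (elim holomorphic_several_subset) auto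
    ultimately have "holomorphic_several (\<lambda>q. (f (q + t k *s v) - f q) * inverse (t k)) (ball p (r/2))"
      by (intro holomorphic_several_mult holomorphic_several_const holomorphic_several_diff)
    then show "holomorphic_several (\<lambda>q. (f (q + t k *s v) - f q) / t k) (ball p (r/2))"
      by (simp only: divide_inverse)
  next
    show "uniform_limit (ball p (r/2)) (\<lambda>k q. (f (q + t k *s v) - f q) / t k)
        (dir_deriv v f) sequentially"
    proof (rule uniform_limitI)
      fix e :: real assume "e > 0"
      then have "\<forall>\<^sub>F k in sequentially. B * cmod (t k) < e"
        by (rule order_tendstoD(2)[OF t_lim])
      then show "\<forall>\<^sub>F k in sequentially. \<forall>q\<in>ball p (r/2).
          dist ((f (q + t k *s v) - f q) / t k) (dir_deriv v f q) < e"
      proof eventually_elim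
        case (elim k)
        show ?case
          unfolding dist_norm by (intro ballI le_less_trans[OF quotient elim] t)
      qed
    qed
  qed (use r in simp)
  then show "\<exists>T. p \<in> T \<and> holomorphic_several (dir_deriv v f) T"
    using r(1) by (intro exI[of _ "ball p (r/2/2)"]) simp
qed

lemma holomorphic_several_iterate:
  "open S \<Longrightarrow> holomorphic_several f S \<Longrightarrow> holomorphic_several ((dir_deriv v ^^ k) f) S"
  by (induction k) (auto intro: holomorphic_several_dir_deriv)

lemma iterate_cong:
  assumes "open S" "holomorphic_several f S" "\<And>p. p \<in> S \<Longrightarrow> f p = g p" "p \<in> S"
  shows "(dir_deriv v ^^ k) g p = (dir_deriv v ^^ k) f p"
  using \<open>p \<in> S\<close>
proof (induction k arbitrary: p)
  case (Suc k)
  from dir_deriv_cong[OF holomorphic_several_iterate[OF assms(1,2)] assms(1) Suc.IH[symmetric] Suc.prems]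
  show ?case by simp
qed (use assms(3) in simp)

text \<open>Stated at every \<open>t\<close> and not only at 0, since differentiating the identity
  once more requires it on a neighbourhood.\<close>

lemma line_higher_deriv:
  assumes "open S" "holomorphic_several f S" "p + t *s v \<in> S"
  shows "(deriv ^^ k) (\<lambda>t. f (p + t *s v)) t = (dir_deriv v ^^ k) f (p + t *s v)"
  using assms(3)
proof (induction k arbitrary: t)
  case (Suc k)
  have "\<forall>\<^sub>F s in nhds t. s \<in> {t. p + t *s v \<in> S}"
    using Suc.prems open_line_preimage[OF \<open>open S\<close>] by (intro eventually_nhds_in_open) auto
  then have "\<forall>\<^sub>F s in nhds t. (deriv ^^ k) (\<lambda>t. f (p + t *s v)) s = (dir_deriv v ^^ k) f (p + s *s v)"
    by (rule eventually_mono) (simp add: Suc.IH)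
  from deriv_cong_ev[OF this refl]
  have "(deriv ^^ Suc k) (\<lambda>t. f (p + t *s v)) t = deriv (\<lambda>s. (dir_deriv v ^^ k) f (p + s *s v)) t"
    by simp
  also have "\<dots> = dir_deriv v ((dir_deriv v ^^ k) f) (p + t *s v)"
    by (intro DERIV_imp_deriv line_deriv[OF holomorphic_several_iterate[OF assms(1,2)] Suc.prems])
  finally show ?case by simp
qed simp

text \<open>A disc of radius \<open>\<rho> / s\<close> serves all \<open>v\<close> of norm at most
  \<open>s\<close>. For \<open>s < \<rho>\<close> the bounds, divided by \<open>fact k\<close>, form
  a convergent geometric series; this is the hypothesis of \<open>Taylor_extension\<close>.\<close>

lemma iterate_bound:
  assumes "open S" "holomorphic_several f S" "cball p \<rho> \<subseteq> S" "\<rho> > 0" "s > 0" "norm v \<le> s"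
    and "\<And>q. q \<in> cball p \<rho> \<Longrightarrow> cmod (f q) \<le> M"
  shows "cmod ((dir_deriv v ^^ k) f p) \<le> fact k * M * (s / \<rho>) ^ k"
proof -
  have "p \<in> S" using assms(3,4) by auto
  then have "(dir_deriv v ^^ k) f p = (deriv ^^ k) (\<lambda>t. f (p + t *s v)) 0"
    using line_higher_deriv[OF assms(1,2), of p 0 v] by simp
  also have "cmod \<dots> \<le> fact k * M / (\<rho> / s) ^ k"
  proof (rule line_Cauchy_bound[OF assms(2,3)])
    show "\<rho> / s * norm v \<le> \<rho>" using assms(4-6) by (simp add: field_simps)
  qed (use assms in auto)
  also have "\<dots> = fact k * M * (s / \<rho>) ^ k" using assms(4,5) by (simp add: power_divide)
  finally show ?thesis .
qed

lemma dir_deriv_lincomb: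
  assumes "finite I" "\<And>j. j \<in> I \<Longrightarrow> holomorphic_several (f j) S" "p \<in> S"
  shows "dir_deriv v (\<lambda>q. \<Sum>j\<in>I. c j * f j q) p = (\<Sum>j\<in>I. c j * dir_deriv v (f j) p)"
  using holomorphic_several_has_derivative(1)[OF assms(2,3)]
  by (intro dir_deriv_eq has_derivative_sum has_derivative_mult_right)

lemma iterate_lincomb:
  assumes "open S" "finite I" "\<And>j. j \<in> I \<Longrightarrow> holomorphic_several (f j) S" "p \<in> S"
  shows "(dir_deriv v ^^ k) (\<lambda>q. \<Sum>j\<in>I. c j * f j q) p = (\<Sum>j\<in>I. c j * (dir_deriv v ^^ k) (f j) p)"
  using \<open>p \<in> S\<close>
proof (induction k arbitrary: p)
  case (Suc k)
  have hol: "holomorphic_several ((dir_deriv v ^^ k) (f j)) S" if "j \<in> I" for j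
    using holomorphic_several_iterate assms that by blast
  then have "holomorphic_several (\<lambda>q. \<Sum>j\<in>I. c j * (dir_deriv v ^^ k) (f j) q) S"
    by (intro holomorphic_several_sum holomorphic_several_cmult)
  from dir_deriv_cong[OF this \<open>open S\<close> Suc.IH[symmetric] Suc.prems]
  have "(dir_deriv v ^^ Suc k) (\<lambda>q. \<Sum>j\<in>I. c j * f j q) p
      = dir_deriv v (\<lambda>q. \<Sum>j\<in>I. c j * (dir_deriv v ^^ k) (f j) q) p" by simp
  also have "\<dots> = (\<Sum>j\<in>I. c j * dir_deriv v ((dir_deriv v ^^ k) (f j)) p)"
    by (rule dir_deriv_lincomb[OF assms(2) hol Suc.prems])
  finally show ?case by simp
qed simp

text \<open>Here the base point is fixed and the direction varies: the homogeneous Taylor component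
  is a polynomial in \<open>z\<close>. The innermost derivative is expanded along the axes and the
  induction hypothesis is applied to the axis derivatives of \<open>f\<close>, so \<open>f\<close>
  has to be arbitrary.\<close>

lemma holomorphic_several_Taylor_coeff:
  assumes "open S" "holomorphic_several f S" "p \<in> S"
  shows "holomorphic_several (\<lambda>z. (dir_deriv z ^^ k) f p) T"
  using assms(2)
proof (induction k arbitrary: f)
  case 0
  show ?case by (simp add: holomorphic_several_const)
next
  case (Suc k)
  have hol: "holomorphic_several (dir_deriv v f) S" for v
    by (rule holomorphic_several_dir_deriv[OF assms(1) Suc.prems])
  have "(dir_deriv z ^^ Suc k) f p = (\<Sum>j\<in>UNIV. z $ j * (dir_deriv z ^^ k) (dir_deriv (axis j 1) f) p)"
    for z
  proof -
    have "dir_deriv z f q = (\<Sum>j\<in>UNIV. z $ j * dir_deriv (axis j 1) f q)" if "q \<in> S" for q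
      by (rule complex_functional_expansion[OF holomorphic_several_has_derivative(2)[OF Suc.prems that]])
    from iterate_cong[OF assms(1) hol this assms(3), where v = z and k = k]
    have "(dir_deriv z ^^ k) (dir_deriv z f) p
        = (dir_deriv z ^^ k) (\<lambda>q. \<Sum>j\<in>UNIV. z $ j * dir_deriv (axis j 1) f q) p" by simp
    also have "\<dots> = (\<Sum>j\<in>UNIV. z $ j * (dir_deriv z ^^ k) (dir_deriv (axis j 1) f) p)"
      by (rule iterate_lincomb[OF assms(1) _ hol assms(3)]) simp
    finally show ?thesis by (simp add: funpow_swap1)
  qed
  moreover have "holomorphic_several
      (\<lambda>z. \<Sum>j\<in>UNIV. z $ j * (dir_deriv z ^^ k) (dir_deriv (axis j 1) f) p) T"
    by (intro holomorphic_several_sum holomorphic_several_mult holomorphic_several_nth Suc.IH hol)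
  ultimately show ?case by simp
qed

text \<open>The Taylor series is summed by homogeneous components, so that no multi-indices occur and
  each component is controlled on a single complex line.\<close>

lemma Taylor_extension:
  assumes "open S" "holomorphic_several f S" "ball p e \<subseteq> S" "e > 0" "\<rho> > 0"
    and bound: "\<And>s v k. 0 < s \<Longrightarrow> s < \<rho> \<Longrightarrow> norm v \<le> s \<Longrightarrow>
      cmod ((dir_deriv v ^^ k) f p) \<le> fact k * M * (s / \<rho>) ^ k"
  shows "\<exists>g. holomorphic_several g (ball p \<rho>) \<and> (\<forall>z\<in>ball p (e/2). g z = f z)"
proof -
  have "p \<in> S" using assms(3,4) by auto
  define a where "a k z = (dir_deriv (z - p) ^^ k) f p / fact k" for k z
  define g where "g z = (\<Sum>k. a k z)" for z
  have hol_a: "holomorphic_several (\<lambda>z. \<Sum>k<n. a k z) T" for n T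
  proof (rule holomorphic_several_sum)
    fix k
    from holomorphic_several_translate[OF holomorphic_several_cmult[OF
      holomorphic_several_Taylor_coeff[OF assms(1,2) \<open>p \<in> S\<close>, of k UNIV], of "1 / fact k"], of "- p" T]
    show "holomorphic_several (a k) T" by (simp add: a_def[abs_def])
  qed
  have unif: "uniform_limit (ball p s) (\<lambda>n z. \<Sum>k<n. a k z) g sequentially" if "0 < s" "s < \<rho>" for s
    unfolding g_def
  proof (rule Weierstrass_m_test)
    show "norm (a k z) \<le> M * (s / \<rho>) ^ k" if "z \<in> ball p s" for k z
      using bound[OF \<open>0 < s\<close> \<open>s < \<rho>\<close>, of "z - p" k] that
      by (simp add: a_def norm_divide dist_norm norm_minus_commute field_simps)
    show "summable (\<lambda>k. M * (s / \<rho>) ^ k)"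
      using that by (intro summable_mult summable_geometric) auto
  qed
  have "holomorphic_several g (ball p \<rho>)"
  proof (rule holomorphic_several_uniform_limit[OF hol_a])
    fix q assume q: "q \<in> ball p \<rho>"
    \<comment> \<open>Halfway between \<open>dist p q\<close> and \<rho>: the ratio
      \<open>s / \<rho>\<close> is below 1, and a ball around \<open>q\<close> still fits into
      \<open>ball p s\<close>.\<close>
    define s where "s = (dist p q + \<rho>) / 2"
    have s: "dist p q < s" "s < \<rho>" "0 < s"
      using q \<open>\<rho> > 0\<close> by (auto simp: s_def add_nonneg_pos)
    have sub: "ball q (s - dist p q) \<subseteq> ball p s"
    proof
      fix x assume "x \<in> ball q (s - dist p q)"
      then show "x \<in> ball p s" using dist_triangle[of p x q] by simp
    qed
    show "\<exists>r>0. ball q r \<subseteq> ball p \<rho> \<and>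
        uniform_limit (ball q r) (\<lambda>n z. \<Sum>k<n. a k z) g sequentially"
    proof (intro exI[of _ "s - dist p q"] conjI)
      show "ball q (s - dist p q) \<subseteq> ball p \<rho>"
        using sub subset_ball[of s \<rho> p] s(2) by auto
      show "uniform_limit (ball q (s - dist p q)) (\<lambda>n z. \<Sum>k<n. a k z) g sequentially"
        by (rule uniform_limit_on_subset[OF unif[OF s(3,2)] sub])
    qed (use s in simp)
  qed
  \<comment> \<open>The point \<open>z\<close> is reached at \<open>t = 1\<close>, which has to be
    interior to the disc of the power series. On the disc of radius 2 the line runs twice as far as
    \<open>z\<close>; hence the half of \<open>e\<close>.\<close>
  moreover have "g z = f z" if "z \<in> ball p (e/2)" for z
  proof -
    let ?h = "\<lambda>t. f (p + t *s (z - p))"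
    have "p + t *s (z - p) \<in> S" if "t \<in> ball 0 2" for t
    proof -
      have "norm (t *s (z - p)) \<le> 2 * norm (z - p)"
        unfolding norm_smult using that by (intro mult_right_mono) auto
      also have "\<dots> < e"
        using \<open>z \<in> ball p (e/2)\<close> by (simp add: dist_norm norm_minus_commute)
      finally have "dist p (p + t *s (z - p)) < e" by (metis add_diff_cancel_left' dist_commute dist_norm)
      then show ?thesis using assms(3) by (auto simp: mem_ball)
    qed
    then have "?h holomorphic_on ball 0 2" by (rule holomorphic_on_line[OF assms(2)])
    from holomorphic_power_series[OF this, of 1]
    have "(\<lambda>k. (deriv ^^ k) ?h 0 / fact k) sums f z" by simp
    moreover have "(deriv ^^ k) ?h 0 / fact k = a k z" for k
      using line_higher_deriv[OF assms(1,2), of p 0 "z - p" k] \<open>p \<in> S\<close> by (simp add: a_def)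
    ultimately show ?thesis by (simp add: g_def sums_iff)
  qed
  ultimately show ?thesis by blast
qed

text \<open>Convexity of \<open>S\<close> makes its slice by the complex line through
  \<open>q\<close> and \<open>z\<close> connected, so the one-variable identity theorem carries the
  zeros near \<open>t = 0\<close> to \<open>t = 1\<close>.\<close>

lemma holomorphic_several_eq_0:
  assumes "open S" "convex S" "holomorphic_several f S" "q \<in> S" "open N" "q \<in> N"
    and zero: "\<And>z. z \<in> N \<Longrightarrow> z \<in> S \<Longrightarrow> f z = 0" and "z \<in> S"
  shows "f z = 0"
proof -
  let ?T = "{t. q + t *s (z - q) \<in> S}" and ?T' = "{t. q + t *s (z - q) \<in> S \<inter> N}"
  have "convex ?T"
    unfolding convex_alt
  proof clarify
    fix a b :: complex and u :: real
    assume ab: "q + a *s (z - q) \<in> S" "q + b *s (z - q) \<in> S" and u: "0 \<le> u" "u \<le> 1"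
    have "q + ((1 - u) *\<^sub>R a + u *\<^sub>R b) *s (z - q)
        = (1 - u) *\<^sub>R (q + a *s (z - q)) + u *\<^sub>R (q + b *s (z - q))"
      unfolding vec_eq_iff vector_add_component vector_scaleR_component vector_smult_component
        vector_minus_component
      by (simp add: scaleR_conv_of_real algebra_simps)
    also have "\<dots> \<in> S" using \<open>convex S\<close> ab u by (simp add: convex_alt)
    finally show "q + ((1 - u) *\<^sub>R a + u *\<^sub>R b) *s (z - q) \<in> S" .
  qed
  then have conn: "connected ?T" by (rule convex_connected)
  have "f (q + 1 *s (z - q)) = 0"
  proof (rule analytic_continuation_open[where s = ?T' and s' = ?T and g = "\<lambda>_. 0" and z = 1])
    show "open ?T'" "open ?T"
      using assms(1,5) by (intro open_line_preimage open_Int; simp)+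
    show "?T' \<noteq> {}"
    proof -
      have "0 \<in> ?T'" using assms(4,6) by simp
      then show ?thesis by blast
    qed
    show "(\<lambda>t. f (q + t *s (z - q))) holomorphic_on ?T"
      by (rule holomorphic_on_line[OF assms(3)]) simp
  qed (use conn zero assms(8) in auto)
  then show ?thesis by simp
qed

section \<open>Charts and holomorphic functions on a manifold\<close>

lemma chart_inv_map: "is_chart c \<Longrightarrow> x \<in> chart_dom c \<Longrightarrow> chart_inv c (chart_map c x) = x"
  unfolding is_chart_def homeomorphism_def by blast

lemma chart_map_inv: "is_chart c \<Longrightarrow> p \<in> chart_map c ` chart_dom c \<Longrightarrow> chart_map c (chart_inv c p) = p"
  unfolding is_chart_def homeomorphism_def by blast

lemma chart_inv_in_dom: "is_chart c \<Longrightarrow> p \<in> chart_map c ` chart_dom c \<Longrightarrow> chart_inv c p \<in> chart_dom c"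
  unfolding is_chart_def homeomorphism_def by blast

lemma open_chart_dom: "is_chart c \<Longrightarrow> open (chart_dom c)"
  unfolding is_chart_def by blast

lemma chart_image_Int:
  assumes "is_chart c"
  shows "chart_map c ` (chart_dom c \<inter> S) = chart_map c ` chart_dom c \<inter> chart_inv c -` S"
  using chart_inv_map[OF assms] by auto

lemma open_chart_image:
  assumes "is_chart c" "open S"
  shows "open (chart_map c ` (chart_dom c \<inter> S))"
  unfolding chart_image_Int[OF assms(1)] using assms
  unfolding is_chart_def homeomorphism_def by (auto intro!: continuous_open_preimage)

lemma chart_inv_image:
  assumes "is_chart c" "T \<subseteq> chart_map c ` chart_dom c"
  shows "chart_inv c ` T = chart_dom c \<inter> chart_map c -` T"
proof (intro equalityI subsetI)
  fix x assume "x \<in> chart_inv c ` T"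
  then obtain p where p: "p \<in> T" "x = chart_inv c p" by blast
  then have "p \<in> chart_map c ` chart_dom c" using assms(2) by blast
  from chart_map_inv[OF assms(1) this] chart_inv_in_dom[OF assms(1) this] p
  show "x \<in> chart_dom c \<inter> chart_map c -` T" by simp
next
  fix x assume "x \<in> chart_dom c \<inter> chart_map c -` T"
  then show "x \<in> chart_inv c ` T"
    using chart_inv_map[OF assms(1), of x] by (intro image_eqI[of _ _ "chart_map c x"]) auto
qed

lemma open_chart_inv_image:
  assumes "is_chart c" "open T" "T \<subseteq> chart_map c ` chart_dom c"
  shows "open (chart_inv c ` T)"
  unfolding chart_inv_image[OF assms(1,3)] using assms
  unfolding is_chart_def homeomorphism_def by (auto intro!: continuous_open_preimage)

lemma continuous_on_chart_inv:
  assumes "is_chart c" "T \<subseteq> chart_map c ` chart_dom c"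
  shows "continuous_on T (chart_inv c)"
proof (rule continuous_on_subset[OF _ assms(2)])
  show "continuous_on (chart_map c ` chart_dom c) (chart_inv c)"
    using assms(1) unfolding is_chart_def homeomorphism_def by blast
qed

lemma continuous_on_chart_map: "is_chart c \<Longrightarrow> continuous_on (chart_dom c) (chart_map c)"
  unfolding is_chart_def homeomorphism_def by blast

lemma compact_chart_inv_image:
  assumes "is_chart c" "compact T" "T \<subseteq> chart_map c ` chart_dom c"
  shows "compact (chart_inv c ` T)"
  using assms by (intro compact_continuous_image continuous_on_chart_inv)

lemma connected_chart_inv_image:
  assumes "is_chart c" "connected T" "T \<subseteq> chart_map c ` chart_dom c"
  shows "connected (chart_inv c ` T)"
  using assms by (intro connected_continuous_image continuous_on_chart_inv)

lemma chart_cball: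
  assumes "is_chart c" "open S" "x \<in> S" "x \<in> chart_dom c"
  obtains r where "r > 0" "cball (chart_map c x) r \<subseteq> chart_map c ` (chart_dom c \<inter> S)"
  using open_contains_cball[THEN iffD1, OF open_chart_image[OF assms(1,2)]] assms(3,4) by blast

lemma hol_funsD:
  "f \<in> hol_funs A S \<Longrightarrow> c \<in> A \<Longrightarrow>
    holomorphic_several (f \<circ> chart_inv c) (chart_map c ` (chart_dom c \<inter> S))"
  unfolding hol_funs_def by blast

lemma hol_funs_subset: "f \<in> hol_funs A U \<Longrightarrow> W \<subseteq> U \<Longrightarrow> f \<in> hol_funs A W"
  unfolding hol_funs_def by (blast intro: holomorphic_several_subset)

lemma hol_funs_const: "(\<lambda>_. a) \<in> hol_funs A U"
  unfolding hol_funs_def by (simp add: o_def holomorphic_several_const)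

lemma hol_funs_add: "f \<in> hol_funs A U \<Longrightarrow> g \<in> hol_funs A U \<Longrightarrow> (\<lambda>x. f x + g x) \<in> hol_funs A U"
  unfolding hol_funs_def by (simp add: o_def holomorphic_several_add)

lemma hol_funs_cmult: "f \<in> hol_funs A U \<Longrightarrow> (\<lambda>x. a * f x) \<in> hol_funs A U"
  unfolding hol_funs_def by (simp add: o_def holomorphic_several_cmult)

lemma hol_funs_power: "f \<in> hol_funs A U \<Longrightarrow> (\<lambda>x. f x ^ k) \<in> hol_funs A U"
  unfolding hol_funs_def by (simp add: o_def holomorphic_several_power)

text \<open>The common ground of the given atlas and the adapted charts; the function theory
  developed here serves both.\<close>

locale atlas =
  fixes A :: "('a::{t2_space,second_countable_topology}, 'n::finite) chart set"
  assumes charts: "c \<in> A \<Longrightarrow> is_chart c"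
    and cover: "\<exists>c\<in>A. x \<in> chart_dom c"
begin

lemma chart_ball_neighbourhood:
  assumes "open S" "x \<in> S"
  obtains c r where "c \<in> A" "r > 0" "x \<in> chart_dom c"
    "cball (chart_map c x) r \<subseteq> chart_map c ` (chart_dom c \<inter> S)"
    "open (chart_inv c ` ball (chart_map c x) r)" "connected (chart_inv c ` ball (chart_map c x) r)"
    "compact (chart_inv c ` cball (chart_map c x) r)"
    "x \<in> chart_inv c ` ball (chart_map c x) r" "chart_inv c ` cball (chart_map c x) r \<subseteq> S"
proof -
  obtain c where c: "c \<in> A" "x \<in> chart_dom c" using cover by blast
  note ch = charts[OF c(1)]
  obtain r where r: "r > 0" "cball (chart_map c x) r \<subseteq> chart_map c ` (chart_dom c \<inter> S)"
    using chart_cball[OF ch assms c(2)] .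
  then have sub: "cball (chart_map c x) r \<subseteq> chart_map c ` chart_dom c" by blast
  then have sub': "ball (chart_map c x) r \<subseteq> chart_map c ` chart_dom c"
    using ball_subset_cball by blast
  show thesis
  proof
    show "open (chart_inv c ` ball (chart_map c x) r)"
      by (rule open_chart_inv_image[OF ch open_ball sub'])
    show "connected (chart_inv c ` ball (chart_map c x) r)"
      by (rule connected_chart_inv_image[OF ch connected_ball sub'])
    show "compact (chart_inv c ` cball (chart_map c x) r)"
      by (rule compact_chart_inv_image[OF ch compact_cball sub])
    show "x \<in> chart_inv c ` ball (chart_map c x) r"
      using r(1) chart_inv_map[OF ch c(2)] by (intro image_eqI[of _ _ "chart_map c x"]) auto
    show "chart_inv c ` cball (chart_map c x) r \<subseteq> S"
      using r(2) unfolding chart_image_Int[OF ch] by blast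
  qed (use c r in auto)
qed

lemma hol_funs_continuous_on:
  assumes "open U" "f \<in> hol_funs A U"
  shows "continuous_on U f"
proof (rule continuous_at_imp_continuous_on, rule ballI)
  fix x assume x: "x \<in> U"
  obtain c where c: "c \<in> A" "x \<in> chart_dom c" using cover by blast
  note ch = charts[OF c(1)]
  have "continuous_on (chart_map c ` (chart_dom c \<inter> U)) (f \<circ> chart_inv c)"
    by (rule holomorphic_several_continuous_on[OF hol_funsD[OF assms(2) c(1)]])
  then have "continuous_on (chart_dom c \<inter> U) (\<lambda>x. (f \<circ> chart_inv c) (chart_map c x))"
    by (rule continuous_on_compose2[OF _ continuous_on_subset[OF continuous_on_chart_map[OF ch]]]) auto
  then have "continuous_on (chart_dom c \<inter> U) f"
    by (rule continuous_on_cong[THEN iffD1, OF refl, rotated]) (simp add: chart_inv_map[OF ch])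
  then show "isCont f x"
    using x c(2) open_Int[OF open_chart_dom[OF ch] assms(1)]
    by (simp add: continuous_on_eq_continuous_at)
qed

text \<open>Closed coordinate balls are compact, so convergence on compact sets is uniform on small
  balls in every chart.\<close>

lemma hol_funs_uniform_limit:
  assumes "open U" "\<And>n. f n \<in> hol_funs A U"
    and lim: "\<And>C. compact C \<Longrightarrow> C \<subseteq> U \<Longrightarrow> uniform_limit C f g sequentially"
  shows "g \<in> hol_funs A U"
  unfolding hol_funs_def
proof (intro CollectI ballI)
  fix c assume c: "c \<in> A"
  note ch = charts[OF c]
  let ?S = "chart_map c ` (chart_dom c \<inter> U)"
  show "holomorphic_several (g \<circ> chart_inv c) ?S"
  proof (rule holomorphic_several_uniform_limit)
    show "holomorphic_several (f n \<circ> chart_inv c) ?S" for n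
      by (rule hol_funsD[OF assms(2) c])
    fix p assume "p \<in> ?S"
    then obtain r where r: "r > 0" "cball p r \<subseteq> ?S"
      using open_chart_image[OF ch assms(1)] open_contains_cball by blast
    have "compact (chart_inv c ` cball p r)"
      using r(2) by (intro compact_chart_inv_image[OF ch compact_cball]) blast
    moreover have "chart_inv c ` cball p r \<subseteq> U"
      using r(2) unfolding chart_image_Int[OF ch] by blast
    ultimately have "uniform_limit (chart_inv c ` cball p r) f g sequentially" by (rule lim)
    then have "uniform_limit (ball p r) (\<lambda>n. f n \<circ> chart_inv c) (g \<circ> chart_inv c) sequentially"
      unfolding uniform_limit_iff by (auto elim!: all_forward eventually_mono)
    moreover have "ball p r \<subseteq> ?S" using r(2) ball_subset_cball by blast
    ultimately show "\<exists>r>0. ball p r \<subseteq> ?S \<and>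
        uniform_limit (ball p r) (\<lambda>n. f n \<circ> chart_inv c) (g \<circ> chart_inv c) sequentially"
      using r(1) by blast
  qed
qed

text \<open>\<open>Z\<close> is the largest open set of agreement. A coordinate ball in
  \<open>W\<close> that meets \<open>Z\<close> lies in it by the convex case, and a ball that misses
  \<open>Z\<close> lies in \<open>Y\<close>; connectedness then leaves \<open>Y\<close> no point of
  \<open>W\<close>.\<close>

lemma hol_funs_identity:
  assumes "open W" "connected W" "f \<in> hol_funs A W" "g \<in> hol_funs A W"
    and V: "open V" "V \<noteq> {}" "V \<subseteq> W" "\<And>x. x \<in> V \<Longrightarrow> f x = g x" and "x \<in> W"
  shows "f x = g x"
proof -
  define Z where "Z = \<Union>{N. open N \<and> N \<subseteq> W \<and> (\<forall>y\<in>N. f y = g y)}"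
  have Z: "open Z" "Z \<subseteq> W" "\<And>y. y \<in> Z \<Longrightarrow> f y = g y" unfolding Z_def by auto
  have max: "N \<subseteq> Z" if "open N" "N \<subseteq> W" "\<And>y. y \<in> N \<Longrightarrow> f y = g y" for N
    using that unfolding Z_def by blast
  define Y where "Y = \<Union>{N. open N \<and> N \<subseteq> W \<and> N \<inter> Z = {}}"
  have Y: "open Y" "Y \<inter> Z = {}" unfolding Y_def by auto
  have "x \<in> Z \<union> Y" if x: "x \<in> W" for x
  proof -
    obtain c r where c: "c \<in> A" "r > 0" "x \<in> chart_dom c"
      "cball (chart_map c x) r \<subseteq> chart_map c ` (chart_dom c \<inter> W)"
      "open (chart_inv c ` ball (chart_map c x) r)" "connected (chart_inv c ` ball (chart_map c x) r)"
      "compact (chart_inv c ` cball (chart_map c x) r)"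
      "x \<in> chart_inv c ` ball (chart_map c x) r" "chart_inv c ` cball (chart_map c x) r \<subseteq> W"
      by (rule chart_ball_neighbourhood[OF assms(1) x])
    note ch = charts[OF c(1)]
    let ?b = "ball (chart_map c x) r"
    have sub: "?b \<subseteq> chart_map c ` (chart_dom c \<inter> W)" "chart_inv c ` ?b \<subseteq> W"
      using c(4,9) ball_subset_cball by blast+
    show ?thesis
    proof (cases "chart_inv c ` ?b \<inter> Z = {}")
      case True
      then have "chart_inv c ` ?b \<subseteq> Y" using c(5) sub(2) unfolding Y_def by blast
      then show ?thesis using c(8) by blast
    next
      case False
      then obtain q where q: "q \<in> ?b" "chart_inv c q \<in> Z" by blast
      have hol: "holomorphic_several (\<lambda>p. (f \<circ> chart_inv c) p - (g \<circ> chart_inv c) p) ?b"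
        by (rule holomorphic_several_diff[OF
            holomorphic_several_subset[OF hol_funsD[OF assms(3) c(1)] sub(1)]
            holomorphic_several_subset[OF hol_funsD[OF assms(4) c(1)] sub(1)]])
      let ?N = "chart_map c ` (chart_dom c \<inter> Z)"
      have qN: "q \<in> ?N" using q sub unfolding chart_image_Int[OF ch] by blast
      have "(f \<circ> chart_inv c) p - (g \<circ> chart_inv c) p = 0" if "p \<in> ?b" for p
      proof (rule holomorphic_several_eq_0[OF open_ball convex_ball hol q(1) _ qN _ that])
        show "open ?N" by (rule open_chart_image[OF ch Z(1)])
        show "(f \<circ> chart_inv c) z - (g \<circ> chart_inv c) z = 0" if "z \<in> ?N" for z
          using that Z(3) unfolding chart_image_Int[OF ch] by auto
      qed
      then have "chart_inv c ` ?b \<subseteq> Z" using c(5) sub(2) by (intro max) auto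
      then show ?thesis using c(8) by blast
    qed
  qed
  then have "W \<subseteq> Z \<union> Y" by blast
  moreover have "Z \<inter> W \<noteq> {}" using max[OF V(1,3,4)] V(2,3) by blast
  ultimately have "Y \<inter> W = {}" using connectedD[OF assms(2) Z(1) Y(1)] Y(2) by blast
  with \<open>W \<subseteq> Z \<union> Y\<close> \<open>x \<in> W\<close> Z(3) show ?thesis by blast
qed

text \<open>Chart balls provide local compactness and second countability a countable subcover. The
  sets are finite unions of compact pieces around members of this open cover, so a compact subset is
  swallowed at some stage.\<close>

lemma compact_exhaustion:
  assumes "open U"
  obtains K :: "nat \<Rightarrow> 'a set" where "\<And>n. compact (K n)" "\<And>n. K n \<subseteq> U"
    "\<And>C. compact C \<Longrightarrow> C \<subseteq> U \<Longrightarrow> \<exists>n. C \<subseteq> K n"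
proof -
  define F where "F = {O'. open O' \<and> (\<exists>C. compact C \<and> O' \<subseteq> C \<and> C \<subseteq> U)}"
  have "x \<in> \<Union>F" if x: "x \<in> U" for x
  proof -
    obtain c r where "c \<in> A" "r > 0" "x \<in> chart_dom c"
      "cball (chart_map c x) r \<subseteq> chart_map c ` (chart_dom c \<inter> U)"
      "open (chart_inv c ` ball (chart_map c x) r)" "connected (chart_inv c ` ball (chart_map c x) r)"
      "compact (chart_inv c ` cball (chart_map c x) r)"
      "x \<in> chart_inv c ` ball (chart_map c x) r" "chart_inv c ` cball (chart_map c x) r \<subseteq> U"
      by (rule chart_ball_neighbourhood[OF assms x])
    moreover have "chart_inv c ` ball (chart_map c x) r \<subseteq> chart_inv c ` cball (chart_map c x) r"
      using ball_subset_cball by blast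
    ultimately show ?thesis unfolding F_def by blast
  qed
  then have UF: "U \<subseteq> \<Union>F" by blast
  have open_F: "open O'" if "O' \<in> F" for O' using that unfolding F_def by blast
  obtain F' where F': "F' \<subseteq> F" "countable F'" "\<Union>F' = \<Union>F"
    using Lindelof[OF open_F] by metis
  \<comment> \<open>Adding the empty set lets \<open>from_nat_into\<close> enumerate the cover even
    if it is empty.\<close>
  have "{} \<in> F" unfolding F_def by auto
  define e where "e = from_nat_into (insert {} F')"
  have e: "range e = insert {} F'"
    unfolding e_def using F'(2) by (intro range_from_nat_into) auto
  have e_F: "e n \<in> F" for n
  proof -
    have "e n \<in> range e" by simp
    then have "e n = {} \<or> e n \<in> F'" unfolding e by simp
    then show ?thesis using subsetD[OF F'(1), of "e n"] \<open>{} \<in> F\<close> by auto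
  qed
  have "\<exists>C. compact C \<and> e n \<subseteq> C \<and> C \<subseteq> U" for n
    using e_F[of n] unfolding F_def by simp
  then obtain C where C: "\<And>n. compact (C n)" "\<And>n. e n \<subseteq> C n" "\<And>n. C n \<subseteq> U" by metis
  show thesis
  proof
    show "compact (\<Union>i\<le>n. C i)" for n using C(1) by auto
    show "(\<Union>i\<le>n. C i) \<subseteq> U" for n using C(3) by (rule UN_least)
    fix D assume D: "compact D" "D \<subseteq> U"
    have "U \<subseteq> (\<Union>n\<in>UNIV. e n)" using UF F'(3) e by auto
    with D have "D \<subseteq> (\<Union>n\<in>UNIV. e n)" by blast
    then obtain I where I: "finite I" "D \<subseteq> (\<Union>n\<in>I. e n)"
      using compactE_image[OF D(1), of UNIV e] open_F[OF e_F] by metis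
    have "D \<subseteq> (\<Union>i\<le>Max (insert 0 I). C i)"
    proof
      fix y assume "y \<in> D"
      then obtain n where "n \<in> I" "y \<in> C n" using I(2) C(2) by blast
      moreover have "n \<le> Max (insert 0 I)" using I(1) \<open>n \<in> I\<close> by simp
      ultimately show "y \<in> (\<Union>i\<le>Max (insert 0 I). C i)" by blast
    qed
    then show "\<exists>n. D \<subseteq> (\<Union>i\<le>n. C i)" by blast
  qed
qed

subsection \<open>Holomorphically convex domains are domains of holomorphy\<close>

text \<open>A function that separates \<open>x\<close> from the hull is scaled to modulus 1 at
  \<open>x\<close>. On \<open>L\<close> its modulus is then at most some \<open>q < 1\<close>, so a
  high power is small there.\<close>

lemma peak_function:
  assumes "open U" "compact L" "L \<subseteq> U" "L \<noteq> {}" "x \<in> U" "x \<notin> hol_hull A U L" "e > 0" "R \<ge> 0"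
  shows "\<exists>h\<in>hol_funs A U. (\<forall>y\<in>L. cmod (h y) \<le> e) \<and> cmod (h x) = R"
proof -
  obtain g where g: "g \<in> hol_funs A U" "(SUP y\<in>L. cmod (g y)) < cmod (g x)"
    using assms(5,6) unfolding hol_hull_def by force
  define M where "M = (SUP y\<in>L. cmod (g y))"
  have "continuous_on L (\<lambda>y. cmod (g y))"
    using continuous_on_subset[OF hol_funs_continuous_on[OF assms(1) g(1)] assms(3)]
    by (rule continuous_on_norm)
  then have "bdd_above ((\<lambda>y. cmod (g y)) ` L)"
    using assms(2) by (intro bounded_imp_bdd_above compact_imp_bounded compact_continuous_image)
  then have M: "cmod (g y) \<le> M" if "y \<in> L" for y unfolding M_def using that by (rule cSUP_upper2) auto
  then have "M \<ge> 0" using assms(4) by (meson all_not_in_conv norm_ge_zero order_trans)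
  define q where "q = M / cmod (g x)"
  have gx: "cmod (g x) > 0" using g(2) \<open>M \<ge> 0\<close> unfolding M_def by linarith
  then have q: "0 \<le> q" "q < 1" using \<open>M \<ge> 0\<close> g(2) unfolding q_def M_def by auto
  have "(\<lambda>k. R * q ^ k) \<longlonglongrightarrow> R * 0"
    using q by (intro tendsto_mult_left LIMSEQ_power_zero) auto
  then have "\<forall>\<^sub>F k in sequentially. R * q ^ k < e"
    using assms(7) by (intro order_tendstoD(2)) auto
  then obtain k where k: "R * q ^ k < e" by (auto simp: eventually_sequentially)
  define h where "h y = complex_of_real R * (inverse (g x) * g y) ^ k" for y
  have "h \<in> hol_funs A U"
    unfolding h_def[abs_def] by (intro hol_funs_cmult hol_funs_power g)
  moreover have "cmod (h y) \<le> e" if "y \<in> L" for y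
  proof -
    have "cmod (inverse (g x) * g y) \<le> q"
      using M[OF that] gx by (simp add: norm_mult norm_inverse q_def divide_inverse mult.commute mult_left_mono)
    then have "cmod (h y) \<le> R * q ^ k"
      unfolding h_def using assms(8) by (simp add: norm_mult norm_power mult_left_mono power_mono)
    then show ?thesis using k by simp
  qed
  moreover have "cmod (h x) = R" using gx assms(8) by (simp add: h_def norm_mult norm_power)
  ultimately show ?thesis by blast
qed

text \<open>Each new peak is small on a compact set that already contains the earlier points, so it
  hardly disturbs the earlier values. These sets also absorb an exhaustion, which makes the series
  converge on compact sets.\<close>

lemma unbounded_function:
  assumes "open U" "holomorphically_convex A U" "W \<subseteq> U" "b \<in> closure W" "b \<notin> U"
  obtains f x where "f \<in> hol_funs A U" "\<And>n. x n \<in> W" "x \<longlonglongrightarrow> b" "\<And>n. real n - 2 \<le> cmod (f (x n))"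
proof -
  obtain K :: "nat \<Rightarrow> 'a set" where K: "\<And>n. compact (K n)" "\<And>n. K n \<subseteq> U"
    "\<And>C. compact C \<Longrightarrow> C \<subseteq> U \<Longrightarrow> \<exists>n. C \<subseteq> K n"
    using compact_exhaustion[OF assms(1)] by metis
  obtain N where N: "\<And>i. open (N i)" "\<And>i. b \<in> N i"
    "\<And>S. open S \<Longrightarrow> b \<in> S \<Longrightarrow> \<forall>\<^sub>F i in sequentially. N i \<subseteq> S"
    using countable_basis_at_decseq[of b] by metis
  have meets: "\<exists>x\<in>W. x \<in> S" if "open S" "b \<in> S" for S
    using assms(4) that open_Int_closure_eq_empty[of S W] by blast
  \<comment> \<open>A state consists of a point, a partial sum and a compact set. Keeping the point
    in the set makes the set nonempty, as \<open>holomorphically_convex\<close> demands, and keeps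
    later corrections small at the point.\<close>
  define P where "P n = (\<lambda>(x, S, L). x \<in> W \<and> x \<in> N n \<and> S \<in> hol_funs A U \<and> compact L \<and> L \<subseteq> U \<and>
    K n \<subseteq> L \<and> x \<in> L \<and> real n \<le> cmod (S x))" for n
  define Q where "Q n = (\<lambda>(x::'a, S, L :: 'a set) (x'::'a, S' :: 'a \<Rightarrow> complex, L' :: 'a set). L \<subseteq> L' \<and>
    (\<forall>y\<in>L. cmod (S' y - S y) \<le> (1/2) ^ n))" for n :: nat
  have "\<exists>s. \<forall>n. P n (s n) \<and> Q n (s n) (s (Suc n))"
  proof (rule dependent_nat_choice)
    obtain x where "x \<in> W" "x \<in> N 0" using meets[OF N(1,2)] by blast
    then have "P 0 (x, (\<lambda>_. 0), insert x (K 0))"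
      using K assms(3) by (auto simp: P_def hol_funs_const)
    then show "\<exists>s. P 0 s" by blast
  next
    fix s n assume "P n s"
    then obtain x S L where s: "s = (x, S, L)" "S \<in> hol_funs A U" "compact L" "L \<subseteq> U" "x \<in> L"
      unfolding P_def by auto
    have "closure (hol_hull A U L) \<subseteq> U"
      using assms(2) s(3-5) unfolding holomorphically_convex_def relatively_compact_in_def by blast
    \<comment> \<open>Convexity enters here: the closure of the hull stays in \<open>U\<close>, so
      near \<open>b\<close> there are points of \<open>W\<close> outside the hull.\<close>
    then have "b \<in> N (Suc n) \<inter> - closure (hol_hull A U L)" using assms(5) N(2)[of "Suc n"] by blast
    moreover have "open (N (Suc n) \<inter> - closure (hol_hull A U L))" using N(1) by (intro open_Int) auto
    ultimately obtain x' where x': "x' \<in> W" "x' \<in> N (Suc n)" "x' \<notin> hol_hull A U L"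
      using meets[of "N (Suc n) \<inter> - closure (hol_hull A U L)"] closure_subset[of "hol_hull A U L"]
      by blast
    \<comment> \<open>The summand \<open>cmod (S x')\<close> outweighs what the previous partial sum
      may contribute at the new point.\<close>
    obtain h where h: "h \<in> hol_funs A U" "\<And>y. y \<in> L \<Longrightarrow> cmod (h y) \<le> (1/2) ^ n"
      "cmod (h x') = real (Suc n) + cmod (S x')"
      using peak_function[OF assms(1) s(3,4) _ _ x'(3), of "(1/2)^n" "real (Suc n) + cmod (S x')"]
        s(5) x'(1) assms(3) by auto
    have "compact (insert x' (L \<union> K (Suc n)))"
      using compact_Un[OF s(3) K(1)] by (rule compact_insert)
    moreover have "cmod (h x') - cmod (S x') \<le> cmod (h x' + S x')" by (rule norm_diff_ineq)
    ultimately have "P (Suc n) (x', (\<lambda>y. h y + S y), insert x' (L \<union> K (Suc n)))"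
      unfolding P_def using x' h s K(1,2) assms(3) by (auto intro: hol_funs_add)
    moreover have "Q n s (x', (\<lambda>y. h y + S y), insert x' (L \<union> K (Suc n)))"
      unfolding Q_def s(1) using h(2) by auto
    ultimately show "\<exists>s'. P (Suc n) s' \<and> Q n s s'" by blast
  qed
  then obtain s where "\<forall>n. P n (s n) \<and> Q n (s n) (s (Suc n))" ..
  then have PQ: "P n (s n)" "Q n (s n) (s (Suc n))" for n by simp_all
  define x where "x n = fst (s n)" for n
  define S where "S n = fst (snd (s n))" for n
  define L where "L n = snd (snd (s n))" for n
  have s: "s n = (x n, S n, L n)" for n by (simp add: x_def S_def L_def)
  have x: "x n \<in> W" "x n \<in> N n" "x n \<in> L n" "real n \<le> cmod (S n (x n))"
    and S: "S n \<in> hol_funs A U" and KL: "K n \<subseteq> L n" for n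
    using PQ(1)[of n] by (auto simp: P_def s)
  have L_Suc: "L n \<subseteq> L (Suc n)" and step: "\<And>y. y \<in> L n \<Longrightarrow> cmod (S (Suc n) y - S n y) \<le> (1/2) ^ n" for n
    using PQ(2)[of n] by (auto simp: Q_def s)
  have L_mono: "L n \<subseteq> L m" if "n \<le> m" for n m
    using L_Suc that by (rule lift_Suc_mono_le)
  \<comment> \<open>The bound is the exact sum of the steps from \<open>n\<close> to
    \<open>m\<close>; with the second term dropped the induction would not close.\<close>
  have tail: "cmod (S m y - S n y) \<le> 2 * (1/2) ^ n - 2 * (1/2) ^ m" if "n \<le> m" "y \<in> L n" for n m y
    using that(1)
  proof (induction m rule: dec_induct)
    case (step m)
    have "y \<in> L m" using L_mono[OF step.hyps(1)] that(2) by blast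
    from \<open>\<And>n y. y \<in> L n \<Longrightarrow> cmod (S (Suc n) y - S n y) \<le> (1/2) ^ n\<close>[OF this] step.IH
      norm_triangle_ineq[of "S (Suc m) y - S m y" "S m y - S n y"]
    show ?case by simp
  qed simp
  define f where "f y = lim (\<lambda>n. S n y)" for y
  have conv: "(\<lambda>n. S n y) \<longlonglongrightarrow> f y" if "y \<in> L n" for y n
  proof -
    have "Cauchy (\<lambda>m. S (m + n) y)"
    proof (rule CauchyI')
      fix e :: real assume "e > 0"
      have "(\<lambda>m. 2 * (1/2) ^ m) \<longlonglongrightarrow> (2 * 0 :: real)"
        by (intro tendsto_mult_left LIMSEQ_power_zero) simp
      then have "\<forall>\<^sub>F m in sequentially. 2 * (1/2) ^ m < e"
        using \<open>e > 0\<close> by (intro order_tendstoD(2)) auto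
      then obtain M where M: "\<And>m. m \<ge> M \<Longrightarrow> 2 * (1/2) ^ m < e"
        by (auto simp: eventually_sequentially)
      have "dist (S (m + n) y) (S (k + n) y) < e" if "m \<ge> M" "k > m" for m k
      proof -
        have "y \<in> L (m + n)" using L_mono[of n "m + n"] \<open>y \<in> L n\<close> by auto
        from tail[OF _ this, of "k + n"] that(2)
        have "cmod (S (k + n) y - S (m + n) y) \<le> 2 * (1/2) ^ (m + n)"
          by (smt (verit) add_right_mono less_imp_le zero_le_power zero_le_divide_1_iff)
        also have "\<dots> < e" using that(1) by (intro M) simp
        finally show ?thesis by (simp add: dist_norm norm_minus_commute)
      qed
      then show "\<exists>M. \<forall>m\<ge>M. \<forall>k>m. dist (S (m + n) y) (S (k + n) y) < e" by blast
    qed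
    then have "convergent (\<lambda>m. S (m + n) y)" by (rule Cauchy_convergent)
    then have "convergent (\<lambda>m. S m y)" by (subst (asm) convergent_ignore_initial_segment)
    then show ?thesis by (simp add: f_def convergent_LIMSEQ_iff)
  qed
  have close: "cmod (f y - S n y) \<le> 2 * (1/2) ^ n" if "y \<in> L n" for y n
  proof (rule LIMSEQ_le_const2)
    show "(\<lambda>m. cmod (S m y - S n y)) \<longlonglongrightarrow> cmod (f y - S n y)"
      by (intro tendsto_intros conv[OF that])
    show "\<exists>M. \<forall>m\<ge>M. cmod (S m y - S n y) \<le> 2 * (1/2) ^ n"
      using tail[OF _ that] by (intro exI[of _ n]) (smt (verit) zero_le_power zero_le_divide_1_iff)
  qed
  show thesis
  proof
    show "f \<in> hol_funs A U"
    proof (rule hol_funs_uniform_limit[OF assms(1) S])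
      fix C assume "compact C" "C \<subseteq> U"
      then obtain j where "C \<subseteq> K j" using K(3) by blast
      then have CL: "C \<subseteq> L m" if "m \<ge> j" for m using KL L_mono[OF that] by blast
      show "uniform_limit C S f sequentially"
      proof (rule uniform_limitI)
        fix e :: real assume "e > 0"
        have "(\<lambda>m. 2 * (1/2) ^ m) \<longlonglongrightarrow> (2 * 0 :: real)"
          by (intro tendsto_mult_left LIMSEQ_power_zero) simp
        then have "\<forall>\<^sub>F m in sequentially. 2 * (1/2) ^ m < e"
          using \<open>e > 0\<close> by (intro order_tendstoD(2)) auto
        then show "\<forall>\<^sub>F m in sequentially. \<forall>y\<in>C. dist (S m y) (f y) < e"
          using eventually_ge_at_top[of j]
        proof eventually_elim
          case (elim m)
          then show ?case
            using close CL[of m] unfolding dist_norm by (metis le_less_trans norm_minus_commute subsetD)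
        qed
      qed
    qed
    show "x n \<in> W" for n by (rule x(1))
    show "x \<longlonglongrightarrow> b"
    proof (rule topological_tendstoI)
      fix T assume "open T" "b \<in> T"
      from N(3)[OF this] show "\<forall>\<^sub>F n in sequentially. x n \<in> T"
        by (rule eventually_mono) (use x(2) in blast)
    qed
    \<comment> \<open>The corrections after stage \<open>n\<close> amount to at most
      \<open>2 * (1/2) ^ n\<close> at \<open>x n\<close>; hence the loss of 2.\<close>
    show "real n - 2 \<le> cmod (f (x n))" for n
    proof -
      have "cmod (S n (x n)) - cmod (f (x n)) \<le> cmod (f (x n) - S n (x n))"
        by (metis norm_minus_commute norm_triangle_ineq2)
      moreover have "(1/2 :: real) ^ n \<le> 1" by (simp add: power_le_one)
      ultimately show ?thesis using close[OF x(3)[of n]] x(4)[of n] by linarith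
    qed
  qed
qed

lemma convex_imp_domain_of_holomorphy:
  assumes "open \<Omega>" "holomorphically_convex A \<Omega>"
  shows "domain_of_holomorphy A \<Omega>"
  unfolding domain_of_holomorphy_def
proof clarify
  fix b U V
  assume b: "b \<in> frontier \<Omega>" "b \<in> U" and U: "open U" "connected U"
    and V: "open V" "V \<subseteq> U \<inter> \<Omega>" "V \<noteq> {}"
    and ext: "\<forall>f\<in>hol_funs A \<Omega>. \<exists>g\<in>hol_funs A U. \<forall>x\<in>V. f x = g x"
  have "b \<notin> \<Omega>" using b(1) assms(1) frontier_disjoint_eq by blast
  obtain v where v: "v \<in> V" using V(3) by blast
  \<comment> \<open>Agreement of \<open>f\<close> with its extension spreads from \<open>V\<close>
    over this component only. The given \<open>b\<close> need not lie in its closure, so another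
    boundary point \<open>b'\<close> is found for the singularity.\<close>
  define W where "W = connected_component_set (U \<inter> \<Omega>) v"
  have W: "connected W" "W \<subseteq> U \<inter> \<Omega>" "v \<in> W"
    unfolding W_def using v V(2) connected_component_subset[of "U \<inter> \<Omega>" v]
    by (auto simp: connected_component_refl_eq)
  have maxW: "C \<subseteq> W" if "connected C" "C \<subseteq> U \<inter> \<Omega>" "C \<inter> W \<noteq> {}" for C
    using connected_component_maximal[of v "C \<union> W" "U \<inter> \<Omega>"] connected_Un[OF that(1) W(1) that(3)]
      that(2) W(2,3) unfolding W_def by blast
  have open_UO: "open (U \<inter> \<Omega>)" using U(1) assms(1) by blast
  have nbh: "\<exists>C. open C \<and> connected C \<and> y \<in> C \<and> C \<subseteq> U \<inter> \<Omega>" if y: "y \<in> U \<inter> \<Omega>" for y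
  proof -
    obtain c r where c: "c \<in> A" "r > 0" "y \<in> chart_dom c"
      "cball (chart_map c y) r \<subseteq> chart_map c ` (chart_dom c \<inter> (U \<inter> \<Omega>))"
      "open (chart_inv c ` ball (chart_map c y) r)" "connected (chart_inv c ` ball (chart_map c y) r)"
      "compact (chart_inv c ` cball (chart_map c y) r)"
      "y \<in> chart_inv c ` ball (chart_map c y) r" "chart_inv c ` cball (chart_map c y) r \<subseteq> U \<inter> \<Omega>"
      by (rule chart_ball_neighbourhood[OF open_UO y])
    have "chart_inv c ` ball (chart_map c y) r \<subseteq> U \<inter> \<Omega>" using c(9) ball_subset_cball by blast
    with c(5,6,8) show ?thesis by blast
  qed
  have openW: "open W"
  proof (subst open_subopen, intro ballI)
    fix y assume y: "y \<in> W"
    then have "y \<in> U \<inter> \<Omega>" using W(2) by blast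
    from nbh[OF this] obtain C where C: "open C" "connected C" "y \<in> C" "C \<subseteq> U \<inter> \<Omega>"
      by (elim exE conjE)
    then have "C \<subseteq> W" using y by (intro maxW) auto
    with C(1,3) show "\<exists>T. open T \<and> y \<in> T \<and> T \<subseteq> W" by blast
  qed
  \<comment> \<open>The connected set \<open>U\<close> contains \<open>v\<close>, which is in
    \<open>W\<close>, and \<open>b\<close>, which is not.\<close>
  have "U \<inter> frontier W \<noteq> {}"
    using W(2,3) b(2) \<open>b \<notin> \<Omega>\<close> by (intro connected_Int_frontier[OF U(2)]) blast+
  then obtain b' where b': "b' \<in> U" "b' \<in> frontier W" by blast
  then have b'W: "b' \<in> closure W" "b' \<notin> W"
    using frontier_disjoint_eq openW by (auto simp: frontier_def interior_open)
  \<comment> \<open>Otherwise \<open>b'\<close> has a connected neighbourhood in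
    \<open>U \<inter> \<Omega>\<close>; it meets \<open>W\<close> and is absorbed by the
    component.\<close>
  have "b' \<notin> \<Omega>"
  proof
    assume "b' \<in> \<Omega>"
    then have "b' \<in> U \<inter> \<Omega>" using b'(1) by blast
    from nbh[OF this] obtain C where C: "open C" "connected C" "b' \<in> C" "C \<subseteq> U \<inter> \<Omega>"
      by (elim exE conjE)
    then have "C \<inter> W \<noteq> {}" using b'W(1) open_Int_closure_eq_empty[of C W] by blast
    then have "C \<subseteq> W" using C by (intro maxW) auto
    then show False using C(3) b'W(2) by blast
  qed
  obtain f x where f: "f \<in> hol_funs A \<Omega>" "\<And>n. x n \<in> W" "x \<longlonglongrightarrow> b'"
    "\<And>n. real n - 2 \<le> cmod (f (x n))"
    using unbounded_function[OF assms _ b'W(1) \<open>b' \<notin> \<Omega>\<close>] W(2) by blast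
  obtain g where g: "g \<in> hol_funs A U" "\<And>x. x \<in> V \<Longrightarrow> f x = g x" using ext f(1) by blast
  have fg: "f (x n) = g (x n)" for n
  proof (rule hol_funs_identity[OF openW W(1) _ _ _ _ _ _ f(2)])
    show "f \<in> hol_funs A W" "g \<in> hol_funs A W"
      using hol_funs_subset[OF f(1)] hol_funs_subset[OF g(1)] W(2) by blast+
    show "open (V \<inter> W)" "V \<inter> W \<noteq> {}" "V \<inter> W \<subseteq> W" using V(1) openW v W(3) by auto
  qed (use g(2) in blast)
  have "isCont g b'"
    using hol_funs_continuous_on[OF U(1) g(1)] U(1) b'(1) by (simp add: continuous_on_eq_continuous_at)
  then have "(\<lambda>n. cmod (g (x n))) \<longlonglongrightarrow> cmod (g b')"
    by (intro tendsto_norm isCont_tendsto_compose[OF _ f(3)])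
  then have "\<forall>\<^sub>F n in sequentially. cmod (g (x n)) < cmod (g b') + 1"
    by (rule order_tendstoD(2)) simp
  \<comment> \<open>The 3 covers the loss of 2 in the growth of \<open>f\<close> and the margin of 1
    in the bound for \<open>g\<close>.\<close>
  moreover have "\<forall>\<^sub>F n in sequentially. real n \<ge> cmod (g b') + 3"
    using filterlim_real_sequentially unfolding filterlim_at_top by blast
  ultimately have "\<forall>\<^sub>F n in sequentially. False"
  proof eventually_elim
    case (elim n)
    then show ?case using f(4)[of n] fg[of n] by simp
  qed
  then show False by simp
qed

end

section \<open>Coordinates adapted to a closed coframe\<close>

lemma vec_linear_iff:
  fixes D :: "complex ^ 'n::finite \<Rightarrow> complex ^ 'm::finite"
  shows "Vector_Spaces.linear (*s) (*s) D \<longleftrightarrow>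
    (\<forall>u v. D (u + v) = D u + D v) \<and> (\<forall>c u. D (c *s u) = c *s D u)"
  unfolding Vector_Spaces.linear_def module_hom_def module_hom_axioms_def module_iff_vector_space
  by (simp add: vec.vector_space_axioms)

lemma vec_linear_imp_linear:
  fixes D :: "complex ^ 'n::finite \<Rightarrow> complex ^ 'm::finite"
  assumes "Vector_Spaces.linear (*s) (*s) D"
  shows "linear D"
  using assms unfolding vec_linear_iff
  by (intro linearI) (auto simp: smult_of_real[symmetric])

lemma vec_linear_inverse:
  fixes D :: "complex ^ 'n::finite \<Rightarrow> complex ^ 'n"
  assumes "Vector_Spaces.linear (*s) (*s) D" "\<And>v. D v = 0 \<Longrightarrow> v = 0"
  obtains E where "Vector_Spaces.linear (*s) (*s) E" "E \<circ> D = id" "D \<circ> E = id"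
proof -
  have lin: "linear D" by (rule vec_linear_imp_linear[OF assms(1)])
  have "inj D" using linear_injective_0[OF lin] assms(2) by blast
  then obtain E where E: "Vector_Spaces.linear (*s) (*s) E" "E \<circ> D = id"
    using vec.linear_injective_left_inverse[OF assms(1)] by blast
  have "surj D" using linear_injective_imp_surjective[OF lin \<open>inj D\<close>] by simp
  have "D (E w) = w" for w
  proof -
    obtain v where "w = D v" using \<open>surj D\<close> by (rule surjE)
    then show ?thesis using fun_cong[OF E(2), of v] by simp
  qed
  then have "D \<circ> E = id" by (simp add: fun_eq_iff)
  with E show thesis by (rule that)
qed

lemma holomorphic_several_componentI:
  fixes F :: "complex ^ 'n::finite \<Rightarrow> complex ^ 'm::finite"
  assumes "\<And>p. p \<in> S \<Longrightarrow> \<exists>D. (F has_derivative D) (at p) \<and> Vector_Spaces.linear (*s) (*s) D"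
  shows "holomorphic_several (\<lambda>p. F p $ j) S"
  unfolding holomorphic_several_def
proof
  fix p assume "p \<in> S"
  then obtain D where D: "(F has_derivative D) (at p)" "Vector_Spaces.linear (*s) (*s) D"
    using assms by blast
  have "((\<lambda>p. F p $ j) has_derivative (\<lambda>v. D v $ j)) (at p)"
    by (rule bounded_linear.has_derivative[OF bounded_linear_vec_nth D(1)])
  moreover have "complex_functional (\<lambda>v. D v $ j)"
    using D(2) by (simp add: complex_functional_iff vec_linear_iff)
  ultimately show "\<exists>D. ((\<lambda>p. F p $ j) has_derivative D) (at p) \<and> complex_functional D" by blast
qed

text \<open>The primitive is the integral of the form along the segment from \<open>p\<close> to
  \<open>q\<close>. Closedness turns the derivative of the integrand in direction \<open>w\<close>
  into the \<open>t\<close>-derivative of \<open>t * a (pt q t) w\<close>, whose integral over [0,1]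
  is \<open>a q w\<close>.\<close>

lemma Poincare_lemma:
  fixes a :: "complex ^ 'n::finite \<Rightarrow> complex ^ 'n \<Rightarrow> complex"
  assumes S: "open S" "convex S" "p \<in> S"
    and lin: "\<And>q. q \<in> S \<Longrightarrow> complex_functional (a q)"
    and hol: "\<And>v. holomorphic_several (\<lambda>q. a q v) S"
    and sym: "\<And>q v w. q \<in> S \<Longrightarrow> dir_deriv w (\<lambda>q. a q v) q = dir_deriv v (\<lambda>q. a q w) q"
  shows "\<exists>u. \<forall>q\<in>S. (u has_derivative a q) (at q)"
proof -
  define pt where "pt q t = p + complex_of_real t *s (q - p)" for q t
  have pt_in: "pt q t \<in> S" if "q \<in> S" "t \<in> cbox 0 1" for q t
  proof -
    have "pt q t = (1 - t) *\<^sub>R p + t *\<^sub>R q"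
      by (simp add: pt_def smult_of_real algebra_simps)
    also have "\<dots> \<in> S" using S(2,3) that by (simp add: convex_alt)
    finally show ?thesis .
  qed
  have cont_pt: "continuous_on T (\<lambda>z. pt (fst z) (snd z))" for T
    unfolding pt_def smult_of_real by (intro continuous_intros)
  \<comment> \<open>Both the covector and its argument \<open>q - p\<close> depend on
    \<open>q\<close>; expansion along the axes reduces the derivative to the product rule.\<close>
  define D where "D q t w = (\<Sum>j\<in>UNIV. (q - p) $ j *
      dir_deriv (complex_of_real t *s w) (\<lambda>x. a x (axis j 1)) (pt q t) + w $ j * a (pt q t) (axis j 1))"
    for q t w
  have f_eq: "a (pt q t) (q - p) = (\<Sum>j\<in>UNIV. (q - p) $ j * a (pt q t) (axis j 1))"
    if "q \<in> S" "t \<in> cbox 0 1" for q t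
    by (rule complex_functional_expansion[OF lin[OF pt_in[OF that]]])
  have deriv: "((\<lambda>q. a (pt q t) (q - p)) has_derivative D q t) (at q)"
    if q: "q \<in> S" and t: "t \<in> cbox 0 1" for q t
  proof -
    have pt_deriv: "((\<lambda>q. pt q t) has_derivative (\<lambda>w. complex_of_real t *s w)) (at q)"
      unfolding pt_def
      by (auto intro!: derivative_eq_intros bounded_linear.has_derivative[OF bounded_linear_smult_right])
    have nth: "((\<lambda>q. (q - p) $ j) has_derivative (\<lambda>w. w $ j)) (at q)" for j
    proof -
      have "((\<lambda>q. q - p) has_derivative (\<lambda>w. w)) (at q)" by (auto intro!: derivative_eq_intros)
      from bounded_linear.has_derivative[OF bounded_linear_vec_nth this] show ?thesis .
    qed
    have "((\<lambda>q. a (pt q t) (axis j 1)) has_derivative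
        (\<lambda>w. dir_deriv (complex_of_real t *s w) (\<lambda>x. a x (axis j 1)) (pt q t))) (at q)" for j
      using diff_chain_at[OF pt_deriv holomorphic_several_has_derivative(1)[OF hol pt_in[OF that]]]
      by (simp add: o_def)
    then have "((\<lambda>q. \<Sum>j\<in>UNIV. (q - p) $ j * a (pt q t) (axis j 1)) has_derivative D q t) (at q)"
      unfolding D_def by (intro has_derivative_sum has_derivative_mult nth)
    then show ?thesis
      by (rule has_derivative_transform_within_open[OF _ S(1) q]) (rule f_eq[OF _ t, symmetric])
  qed
  have bl: "bounded_linear (D q t)" if "q \<in> S" "t \<in> cbox 0 1" for q t
    using deriv[OF that] by (rule has_derivative_bounded_linear)
  \<comment> \<open>Closedness exchanges \<open>w\<close> with the axis directions, after which the
    sum reassembles into a derivative along the segment.\<close>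
  have D_simp: "D q t w = t * dir_deriv (q - p) (\<lambda>x. a x w) (pt q t) + a (pt q t) w"
    if q: "q \<in> S" and t: "t \<in> cbox 0 1" for q t w
  proof -
    note P = pt_in[OF that]
    have swap: "dir_deriv (complex_of_real t *s w) (\<lambda>x. a x (axis j 1)) (pt q t) =
        t * dir_deriv (axis j 1) (\<lambda>x. a x w) (pt q t)" for j
      using complex_functional_smult[OF holomorphic_several_has_derivative(2)[OF hol P]] sym[OF P]
      by simp
    have "D q t w = (\<Sum>j\<in>UNIV. (q - p) $ j *
        dir_deriv (complex_of_real t *s w) (\<lambda>x. a x (axis j 1)) (pt q t)) +
        (\<Sum>j\<in>UNIV. w $ j * a (pt q t) (axis j 1))"
      by (simp add: D_def sum.distrib)
    also have "(\<Sum>j\<in>UNIV. w $ j * a (pt q t) (axis j 1)) = a (pt q t) w"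
      by (rule complex_functional_expansion[OF lin[OF P], symmetric])
    also have "(\<Sum>j\<in>UNIV. (q - p) $ j *
        dir_deriv (complex_of_real t *s w) (\<lambda>x. a x (axis j 1)) (pt q t)) =
        t * (\<Sum>j\<in>UNIV. (q - p) $ j * dir_deriv (axis j 1) (\<lambda>x. a x w) (pt q t))"
      unfolding swap by (simp add: sum_distrib_left mult.left_commute)
    also have "(\<Sum>j\<in>UNIV. (q - p) $ j * dir_deriv (axis j 1) (\<lambda>x. a x w) (pt q t)) =
        dir_deriv (q - p) (\<lambda>x. a x w) (pt q t)"
      by (rule complex_functional_expansion[OF holomorphic_several_has_derivative(2)[OF hol P], symmetric])
    finally show ?thesis .
  qed
  have comp_cont: "continuous_on (S \<times> cbox 0 1) (\<lambda>z. h (pt (fst z) (snd z)))"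
    if "continuous_on S h" for h :: "complex ^ 'n \<Rightarrow> complex"
    by (rule continuous_on_compose2[OF that cont_pt]) (use pt_in in auto)
  have cont_a: "continuous_on S (\<lambda>x. a x v)" for v
    by (rule holomorphic_several_continuous_on[OF hol])
  have cont_d: "continuous_on S (dir_deriv w (\<lambda>x. a x v))" for v w
    by (rule holomorphic_several_continuous_on[OF holomorphic_several_dir_deriv[OF S(1) hol]])
  \<comment> \<open>Differentiation under the integral asks for a derivative that is jointly
    continuous as a bounded operator; in finite dimension continuity on each vector
    suffices.\<close>
  define F where "F q t = Blinfun (D q t)" for q t
  have F: "blinfun_apply (F q t) = D q t" if "q \<in> S" "t \<in> cbox 0 1" for q t
    unfolding F_def by (rule bounded_linear_Blinfun_apply[OF bl[OF that]])
  have cont_F: "continuous_on (S \<times> cbox 0 1) (\<lambda>(q, t). F q t)"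
  proof (rule continuous_on_blinfun_componentwise)
    fix w :: "complex ^ 'n"
    have "continuous_on (S \<times> cbox 0 1) (\<lambda>z. \<Sum>j\<in>UNIV. (fst z - p) $ j *
        (complex_of_real (snd z) * dir_deriv w (\<lambda>x. a x (axis j 1)) (pt (fst z) (snd z))) +
        w $ j * a (pt (fst z) (snd z)) (axis j 1))"
      by (intro continuous_intros comp_cont[OF cont_a] comp_cont[OF cont_d])
    moreover have "blinfun_apply (case z of (q, t) \<Rightarrow> F q t) w = (\<Sum>j\<in>UNIV. (fst z - p) $ j *
        (complex_of_real (snd z) * dir_deriv w (\<lambda>x. a x (axis j 1)) (pt (fst z) (snd z))) +
        w $ j * a (pt (fst z) (snd z)) (axis j 1))" if z_in: "z \<in> S \<times> cbox 0 1" for z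
    proof -
      obtain q t where z: "z = (q, t)" "q \<in> S" "t \<in> cbox 0 1"
        using z_in by (metis SigmaE)
      from complex_functional_smult[OF holomorphic_several_has_derivative(2)[OF hol pt_in[OF z(2,3)]]]
      show ?thesis unfolding z(1) prod.case fst_conv snd_conv F[OF z(2,3)] D_def by simp
    qed
    ultimately show "continuous_on (S \<times> cbox 0 1) (\<lambda>z. blinfun_apply (case z of (q, t) \<Rightarrow> F q t) w)"
      by (simp cong: continuous_on_cong)
  qed
  define u where "u q = integral (cbox 0 1) (\<lambda>t. a (pt q t) (q - p))" for q
  have "(u has_derivative a q) (at q)" if q: "q \<in> S" for q
  proof -
    have pair: "continuous_on (cbox 0 1) (\<lambda>t. (x, t))" for x :: "complex ^ 'n"
      by (intro continuous_on_Pair continuous_on_const continuous_on_id)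
    have pair_in: "(\<lambda>t. (x, t)) ` cbox 0 1 \<subseteq> S \<times> cbox 0 1" if "x \<in> S" for x
      using that by auto
    have slice: "continuous_on (cbox 0 1) (\<lambda>t. h (pt x t))"
      if "continuous_on S h" "x \<in> S" for h :: "complex ^ 'n \<Rightarrow> complex" and x
      using continuous_on_compose2[OF comp_cont[OF that(1)] pair pair_in[OF that(2)]] by simp
    have "((\<lambda>x. integral (cbox 0 1) (\<lambda>t. a (pt x t) (x - p))) has_derivative
        blinfun_apply (integral (cbox 0 1) (F q))) (at q within S)"
    proof (rule leibniz_rule[OF _ _ cont_F q S(2)])
      show "((\<lambda>x. a (pt x t) (x - p)) has_derivative blinfun_apply (F x t)) (at x within S)"
        if "x \<in> S" "t \<in> cbox 0 1" for x t
        unfolding F[OF that] using deriv[OF that] by (rule has_derivative_at_withinI)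
      show "(\<lambda>t. a (pt x t) (x - p)) integrable_on cbox 0 1" if "x \<in> S" for x
        by (rule integrable_continuous[OF slice[OF cont_a that]])
    qed
    then have u_deriv: "(u has_derivative blinfun_apply (integral (cbox 0 1) (F q))) (at q)"
      unfolding u_def[abs_def] using at_within_open[OF q S(1)] by simp
    have "blinfun_apply (integral (cbox 0 1) (F q)) w = a q w" for w
    proof -
      have "continuous_on (cbox 0 1) (F q)"
        using continuous_on_compose2[OF cont_F pair pair_in[OF q]] by simp
      then have "blinfun_apply (integral (cbox 0 1) (F q)) w
          = integral (cbox 0 1) (\<lambda>t. blinfun_apply (F q t) w)"
        by (intro blinfun_apply_integral integrable_continuous)
      also have "\<dots> = integral (cbox 0 1) (\<lambda>t. D q t w)"
        using F[OF q] by (intro integral_cong) simp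
      also have "((\<lambda>t. D q t w) has_integral (1 * a (pt q 1) w - 0 * a (pt q 0) w)) {0..1}"
      proof -
        have "((\<lambda>t. complex_of_real t * a (pt q t) w) has_vector_derivative D q t w) (at t within {0..1})"
          if "t \<in> {0..1}" for t
        proof -
          have t: "t \<in> cbox 0 1" using that by simp
          have "((\<lambda>s. s * a (p + s *s (q - p)) w) has_field_derivative
              (1 * a (pt q t) w + dir_deriv (q - p) (\<lambda>x. a x w) (pt q t) * of_real t)) (at (of_real t))"
            unfolding pt_def
            by (intro DERIV_mult DERIV_ident line_deriv[OF hol] pt_in[OF q t, unfolded pt_def])
          then have "((\<lambda>s. s * a (p + s *s (q - p)) w) has_field_derivative D q t w) (at (of_real t))"
            unfolding D_simp[OF q t] by (simp add: algebra_simps)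
          from has_vector_derivative_real_field[OF this] show ?thesis by (simp add: pt_def)
        qed
        from fundamental_theorem_of_calculus[OF _ this] show ?thesis by simp
      qed
      then have "integral (cbox 0 1) (\<lambda>t. D q t w) = a (pt q 1) w"
        by (simp add: integral_unique)
      finally show ?thesis by (simp add: pt_def)
    qed
    then have "blinfun_apply (integral (cbox 0 1) (F q)) = a q" by blast
    with u_deriv show ?thesis by simp
  qed
  then show ?thesis by blast
qed

lemma is_chart_compose:
  assumes c: "is_chart c" and h: "homeomorphism S T u g" and S: "open S" "S \<subseteq> chart_map c ` chart_dom c"
    and T: "open T"
  defines "b \<equiv> (chart_inv c ` S, u \<circ> chart_map c)"
  shows "is_chart b" "chart_map b ` chart_dom b = T"
    "\<And>p. p \<in> T \<Longrightarrow> chart_inv b p = chart_inv c (g p)"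
proof -
  have dom: "chart_inv c ` S = chart_dom c \<inter> chart_map c -` S" by (rule chart_inv_image[OF c S(2)])
  have im: "chart_map c ` chart_inv c ` S = S"
    using chart_map_inv[OF c] S(2) by (auto simp: image_image subset_iff)
  have "homeomorphism (chart_dom c) (chart_map c ` chart_dom c) (chart_map c) (chart_inv c)"
    using c unfolding is_chart_def by blast
  then have "homeomorphism (chart_inv c ` S) S (chart_map c) (chart_inv c)"
    by (rule homeomorphism_of_subsets[where T'' = S]) (use dom im S(2) in auto)
  then have comp: "homeomorphism (chart_inv c ` S) T (u \<circ> chart_map c) (chart_inv c \<circ> g)"
    using h by (rule homeomorphism_compose)
  \<comment> \<open>\<open>chart_inv\<close> is fixed as an \<open>inv_into\<close>, so the inverse
    obtained by composition has to be identified with it on \<open>T\<close>.\<close>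
  have inv: "chart_inv b p = (chart_inv c \<circ> g) p" if "p \<in> T" for p
  proof -
    have "inj_on (u \<circ> chart_map c) (chart_inv c ` S)"
      using comp unfolding homeomorphism_def by (metis inj_on_inverseI)
    moreover have "(chart_inv c \<circ> g) p \<in> chart_inv c ` S" "(u \<circ> chart_map c) ((chart_inv c \<circ> g) p) = p"
      using comp that unfolding homeomorphism_def by blast+
    ultimately show ?thesis unfolding b_def chart_inv_def[of "(_, _)"] fst_conv snd_conv
      by (metis inv_into_f_f)
  qed
  then show "chart_inv b p = chart_inv c (g p)" if "p \<in> T" for p using that by simp
  show img: "chart_map b ` chart_dom b = T"
    using comp unfolding homeomorphism_def b_def by simp
  have "open (chart_inv c ` S)" by (rule open_chart_inv_image[OF c S])
  moreover have "homeomorphism (chart_inv c ` S) T (u \<circ> chart_map c) (chart_inv b)"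
    using homeomorphism_cong[OF comp refl refl refl inv] .
  ultimately show "is_chart b" using T img unfolding is_chart_def by (simp add: b_def)
qed

text \<open>Locally \<open>f \<circ> chart_inv b\<close> is \<open>f \<circ> chart_inv c\<close>
  after the transition from \<open>b\<close> to \<open>c\<close>. Applied in both directions, this
  compares two atlases.\<close>

lemma hol_funs_transfer:
  assumes "\<And>c. c \<in> A \<Longrightarrow> is_chart c" "\<And>b. b \<in> B \<Longrightarrow> is_chart b" "\<And>x. \<exists>c\<in>A. x \<in> chart_dom c"
    and hol: "\<And>b c j. b \<in> B \<Longrightarrow> c \<in> A \<Longrightarrow>
      holomorphic_several (\<lambda>p. transition b c p $ j) (chart_map b ` (chart_dom b \<inter> chart_dom c))"
    and U: "open U" and f: "f \<in> hol_funs A U"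
  shows "f \<in> hol_funs B U"
  unfolding hol_funs_def
proof (intro CollectI ballI)
  fix b assume b: "b \<in> B"
  note chb = assms(2)[OF b]
  show "holomorphic_several (f \<circ> chart_inv b) (chart_map b ` (chart_dom b \<inter> U))"
  proof (rule holomorphic_several_locally)
    fix p assume "p \<in> chart_map b ` (chart_dom b \<inter> U)"
    then obtain x where x: "p = chart_map b x" "x \<in> chart_dom b" "x \<in> U" by blast
    obtain c where c: "c \<in> A" "x \<in> chart_dom c" using assms(3) by blast
    note chc = assms(1)[OF c(1)]
    let ?T = "chart_map b ` (chart_dom b \<inter> (chart_dom c \<inter> U))"
    have "?T \<subseteq> chart_map b ` (chart_dom b \<inter> chart_dom c)" by blast
    note hol_T = holomorphic_several_subset[OF hol[OF b c(1)] this]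
    have inv: "chart_inv b q \<in> chart_dom c \<inter> U" if "q \<in> ?T" for q
      using that unfolding chart_image_Int[OF chb] by blast
    have "transition b c ` ?T \<subseteq> chart_map c ` (chart_dom c \<inter> U)"
      using inv unfolding transition_def by fastforce
    from holomorphic_several_compose[OF hol_funsD[OF f c(1)] hol_T this]
    have "holomorphic_several ((f \<circ> chart_inv c) \<circ> transition b c) ?T" .
    then have "holomorphic_several (f \<circ> chart_inv b) ?T"
    proof (rule holomorphic_several_cong)
      show "open ?T" by (rule open_chart_image[OF chb open_Int[OF open_chart_dom[OF chc] U]])
      show "((f \<circ> chart_inv c) \<circ> transition b c) q = (f \<circ> chart_inv b) q" if "q \<in> ?T" for q
        using inv[OF that] chart_inv_map[OF chc] by (simp add: transition_def)
    qed
    moreover have "p \<in> ?T" using x c(2) by blast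
    ultimately show "\<exists>T. p \<in> T \<and> holomorphic_several (f \<circ> chart_inv b) T"
      by (intro exI[of _ ?T] conjI)
  qed
qed

section \<open>Charts whose differentials are the given coframe\<close>

locale closed_coframe = atlas A
  for A :: "('a::{t2_space,second_countable_topology}, 'n::finite) chart set" +
  fixes \<omega> :: "'n \<Rightarrow> ('a, 'n) form1"
  assumes manifold: "complex_manifold A"
    and coframe: "holomorphic_coframe A \<omega>"
    and closed: "closed_form1 A (\<omega> j)"
begin

text \<open>The whole coframe at \<open>x\<close> as one vector-valued covector. It is the
  derivative that an adapted coordinate map has in the coordinates of \<open>c\<close>.\<close>

definition coframe_map :: "('a, 'n) chart \<Rightarrow> 'a \<Rightarrow> complex ^ 'n \<Rightarrow> complex ^ 'n" where
  "coframe_map c x v = (\<chi> j. \<omega> j c x v)"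

lemma form: "holomorphic_form1 A (\<omega> j)"
  using coframe unfolding holomorphic_coframe_def by blast

lemma form_linear: "c \<in> A \<Longrightarrow> x \<in> chart_dom c \<Longrightarrow> complex_functional (\<omega> j c x)"
  using form[of j] unfolding holomorphic_form1_def by blast

lemma form_transform:
  "c \<in> A \<Longrightarrow> c' \<in> A \<Longrightarrow> x \<in> chart_dom c \<inter> chart_dom c' \<Longrightarrow>
    \<omega> j c x v = \<omega> j c' x (frechet_derivative (transition c c') (at (chart_map c x)) v)"
  using form[of j] unfolding holomorphic_form1_def by blast

lemma form_holomorphic:
  "c \<in> A \<Longrightarrow> holomorphic_several (\<lambda>p. \<omega> j c (chart_inv c p) v) (chart_map c ` chart_dom c)"
  using form[of j] unfolding holomorphic_form1_def by blast

lemma coframe_map_linear: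
  "c \<in> A \<Longrightarrow> x \<in> chart_dom c \<Longrightarrow> Vector_Spaces.linear (*s) (*s) (coframe_map c x)"
  using form_linear[of c x] by (simp add: vec_linear_iff coframe_map_def complex_functional_iff vec_eq_iff)

text \<open>The coordinate functionals are combinations of the forms, so a vector killed by all
  forms vanishes; equality of dimensions does the rest.\<close>

lemma coframe_map_inverse:
  assumes "c \<in> A" "x \<in> chart_dom c"
  obtains E where "Vector_Spaces.linear (*s) (*s) E" "E \<circ> coframe_map c x = id" "coframe_map c x \<circ> E = id"
proof (rule vec_linear_inverse[OF coframe_map_linear[OF assms]])
  fix v assume "coframe_map c x v = 0"
  then have zero: "\<omega> j c x v = 0" for j by (simp add: coframe_map_def vec_eq_iff)
  have "v $ i = 0" for i
  proof -
    have "complex_functional (\<lambda>v. v $ i)" by (simp add: complex_functional_iff)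
    then have "\<exists>!b :: complex ^ 'n. (\<lambda>v. v $ i) = (\<lambda>v. \<Sum>j\<in>UNIV. b $ j * \<omega> j c x v)"
      using coframe assms unfolding holomorphic_coframe_def by blast
    then obtain b :: "complex ^ 'n" where "(\<lambda>v. v $ i) = (\<lambda>v. \<Sum>j\<in>UNIV. b $ j * \<omega> j c x v)" by blast
    from fun_cong[OF this, of v] show ?thesis by (simp add: zero)
  qed
  then show "v = 0" by (simp add: vec_eq_iff)
qed (rule that)

text \<open>Each component of the coordinate map is a primitive of the corresponding form, read in
  every chart of \<open>A\<close>. All such charts are collected, so no family has to be
  chosen.\<close>

definition adapted :: "('a, 'n) chart set" where
  "adapted = {b. is_chart b \<and> (\<forall>c\<in>A. \<forall>x\<in>chart_dom b \<inter> chart_dom c.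
     (transition c b has_derivative coframe_map c x) (at (chart_map c x)))}"

lemma adapted_chart: "b \<in> adapted \<Longrightarrow> is_chart b"
  unfolding adapted_def by blast

lemma adaptedD:
  "b \<in> adapted \<Longrightarrow> c \<in> A \<Longrightarrow> x \<in> chart_dom b \<Longrightarrow> x \<in> chart_dom c \<Longrightarrow>
    (transition c b has_derivative coframe_map c x) (at (chart_map c x))"
  unfolding adapted_def by blast

text \<open>The transformation law of the forms in the shape of a chain rule for
  \<open>coframe_map\<close>.\<close>

lemma transition_has_derivative:
  assumes "c \<in> A" "c' \<in> A" "x \<in> chart_dom c" "x \<in> chart_dom c'"
  shows "\<exists>D. (transition c c' has_derivative D) (at (chart_map c x)) \<and>
    coframe_map c x = coframe_map c' x \<circ> D"
proof -
  have "holomorphic_several (\<lambda>p. transition c c' p $ j) (chart_map c ` (chart_dom c \<inter> chart_dom c'))" for j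
    using manifold assms(1,2) unfolding complex_manifold_def by blast
  moreover have "chart_map c x \<in> chart_map c ` (chart_dom c \<inter> chart_dom c')" using assms by blast
  ultimately obtain D where D: "(transition c c' has_derivative D) (at (chart_map c x))"
    using has_derivative_vec_holomorphic by blast
  have "D = frechet_derivative (transition c c') (at (chart_map c x))"
    by (rule frechet_derivative_at[OF D])
  then have "coframe_map c x = coframe_map c' x \<circ> D"
    using form_transform[OF assms(1,2)] assms(3,4) by (simp add: fun_eq_iff coframe_map_def)
  with D show ?thesis by blast
qed

lemma transition_compose_eq:
  assumes "is_chart c" "is_chart d" "p \<in> chart_map c ` (chart_dom c \<inter> chart_dom d)"
  shows "transition d e (transition c d p) = transition c e p"
proof -
  obtain x where "x \<in> chart_dom c" "x \<in> chart_dom d" "p = chart_map c x" using assms(3) by blast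
  then show ?thesis by (simp add: transition_def chart_inv_map assms(1,2))
qed

lemma adapted_cover: "\<exists>b\<in>adapted. x \<in> chart_dom b"
proof -
  obtain c where c: "c \<in> A" "x \<in> chart_dom c" using cover by blast
  note chc = charts[OF c(1)]
  obtain r where r: "r > 0" "cball (chart_map c x) r \<subseteq> chart_map c ` (chart_dom c \<inter> UNIV)"
    using chart_cball[OF chc open_UNIV UNIV_I c(2)] .
  define S where "S = ball (chart_map c x) r"
  have S: "open S" "convex S" "chart_map c x \<in> S" "S \<subseteq> chart_map c ` chart_dom c"
    using r ball_subset_cball[of "chart_map c x" r] by (auto simp: S_def)
  define a where "a j q v = \<omega> j c (chart_inv c q) v" for j q v
  have a_hol: "holomorphic_several (\<lambda>q. a j q v) S" for j v
    unfolding a_def by (rule holomorphic_several_subset[OF form_holomorphic[OF c(1)] S(4)])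
  have inv_dom: "chart_inv c q \<in> chart_dom c" if "q \<in> S" for q
    using chart_inv_in_dom[OF chc] S(4) that by blast
  have "\<exists>u. \<forall>q\<in>S. (u has_derivative a j q) (at q)" for j
  proof (rule Poincare_lemma[OF S(1-3)])
    show "complex_functional (a j q)" if "q \<in> S" for q
      using form_linear[OF c(1) inv_dom[OF that], of j] by (simp add: a_def[abs_def])
    show "dir_deriv w (\<lambda>q. a j q v) q = dir_deriv v (\<lambda>q. a j q w) q" if "q \<in> S" for q v w
    proof -
      have "ext_deriv (\<omega> j) c (chart_inv c q) w v = 0"
        using closed[of j] c(1) inv_dom[OF that] unfolding closed_form1_def by blast
      moreover have "chart_map c (chart_inv c q) = q" using chart_map_inv[OF chc] S(4) that by blast
      ultimately show ?thesis by (simp add: ext_deriv_def dir_deriv_def a_def)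
    qed
  qed (rule a_hol)
  then obtain u0 where u0: "\<And>j q. q \<in> S \<Longrightarrow> (u0 j has_derivative a j q) (at q)" by metis
  define u where "u q = (\<chi> j. u0 j q)" for q
  define Du where "Du q = coframe_map c (chart_inv c q)" for q
  have u: "(u has_derivative Du q) (at q)" if "q \<in> S" for q
    using u0[OF that] by (intro has_derivative_vec) (simp add: u_def Du_def coframe_map_def a_def[abs_def])
  define F where "F q = Blinfun (Du q)" for q
  have F: "blinfun_apply (F q) = Du q" if "q \<in> S" for q
    unfolding F_def by (rule bounded_linear_Blinfun_apply[OF has_derivative_bounded_linear[OF u[OF that]]])
  have cont_F: "continuous_on S F"
  proof (rule continuous_on_blinfun_componentwise)
    fix w
    have "continuous_on S (\<lambda>q. \<chi> j. a j q w)"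
      by (intro continuous_intros holomorphic_several_continuous_on[OF a_hol])
    then show "continuous_on S (\<lambda>q. blinfun_apply (F q) w)"
      by (simp add: F Du_def coframe_map_def a_def cong: continuous_on_cong)
  qed
  \<comment> \<open>At the centre the derivative is the coframe itself, whose inverse starts the
    inverse function theorem.\<close>
  have "Du (chart_map c x) = coframe_map c x" using chart_inv_map[OF chc c(2)] by (simp add: Du_def)
  then obtain E where E: "Vector_Spaces.linear (*s) (*s) E" "E \<circ> Du (chart_map c x) = id"
    using coframe_map_inverse[OF c] by metis
  have "bounded_linear E" using vec_linear_imp_linear[OF E(1)] by (simp add: linear_conv_bounded_linear)
  then have "Blinfun E o\<^sub>L F (chart_map c x) = id_blinfun"
    using fun_cong[OF E(2)] F[OF S(3)]
    by (intro blinfun_eqI) (simp add: bounded_linear_Blinfun_apply)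
  then obtain S' T g g' where S': "open S'" "S' \<subseteq> S" "chart_map c x \<in> S'" "open T" "homeomorphism S' T u g"
    using inverse_function_theorem[OF S(1) _ cont_F S(3), of u] u F by metis
  define b where "b = (chart_inv c ` S', u \<circ> chart_map c)"
  have S'c: "S' \<subseteq> chart_map c ` chart_dom c" using S'(2) S(4) by blast
  note b_chart = is_chart_compose[OF chc S'(5,1) S'c S'(4), folded b_def]
  have b_dom: "chart_dom b = chart_dom c \<inter> chart_map c -` S'"
    using chart_inv_image[OF chc S'c] by (simp add: b_def)
  have "b \<in> adapted"
    unfolding adapted_def
  proof (intro CollectI conjI ballI b_chart(1))
    \<comment> \<open>Membership concerns every chart \<open>d\<close> of \<open>A\<close>, not only
      the chart \<open>c\<close> from which \<open>b\<close> is built; the chain rule through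
      \<open>c\<close> settles it.\<close>
    fix d y assume d: "d \<in> A" and y: "y \<in> chart_dom b \<inter> chart_dom d"
    note chd = charts[OF d]
    have yc: "y \<in> chart_dom c" "chart_map c y \<in> S'" using y b_dom by auto
    obtain D where D: "(transition d c has_derivative D) (at (chart_map d y))"
      "coframe_map d y = coframe_map c y \<circ> D"
      using transition_has_derivative[OF d c(1)] y yc(1) by blast
    have "transition d c (chart_map d y) = chart_map c y"
      using y chart_inv_map[OF chd] by (simp add: transition_def)
    moreover have "(u has_derivative coframe_map c y) (at (chart_map c y))"
      using u[of "chart_map c y"] yc S'(2) chart_inv_map[OF chc yc(1)] by (auto simp: Du_def)
    ultimately have "(u \<circ> transition d c has_derivative coframe_map c y \<circ> D) (at (chart_map d y))"
      using diff_chain_at[OF D(1)] by simp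
    then have "(transition d b has_derivative coframe_map c y \<circ> D) (at (chart_map d y))"
      by (simp add: transition_def b_def o_assoc)
    then show "(transition d b has_derivative coframe_map d y) (at (chart_map d y))"
      using D(2) by simp
  qed
  moreover have "x \<in> chart_dom b" using b_dom c(2) S'(3) by simp
  ultimately show ?thesis by blast
qed

lemma adapted_transition_inverse:
  assumes b: "b \<in> adapted" "x \<in> chart_dom b" and c: "c \<in> A" "x \<in> chart_dom c"
    and E: "coframe_map c x \<circ> E = id"
  shows "(transition b c has_derivative E) (at (chart_map b x))"
proof -
  note chb = adapted_chart[OF b(1)] and chc = charts[OF c(1)]
  let ?S = "chart_map c ` (chart_dom c \<inter> chart_dom b)"
  have xS: "chart_map c x \<in> ?S" using b c by blast
  have "(transition b c has_derivative E) (at (transition c b (chart_map c x)))"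
  proof (rule has_derivative_inverse_strong[OF _ xS])
    show "open ?S" by (rule open_chart_image[OF chc open_chart_dom[OF chb]])
    show "continuous_on ?S (transition c b)"
      using has_derivative_continuous[OF adaptedD[OF b(1) c(1)]]
      by (auto intro: continuous_at_imp_continuous_on)
    show "transition b c (transition c b p) = p" if "p \<in> ?S" for p
      using that chart_inv_map[OF chc] chart_inv_map[OF chb] by (auto simp: transition_def)
  qed (use adaptedD[OF b(1) c(1) b(2) c(2)] E in auto)
  then show ?thesis using chart_inv_map[OF chc c(2)] by (simp add: transition_def)
qed

text \<open>In the coordinates of a chart \<open>c\<close> of \<open>A\<close> both charts have
  derivative \<open>coframe_map c x\<close>, so their transition has this map composed with its
  inverse.\<close>

lemma adapted_translation:
  assumes "b \<in> adapted" "b' \<in> adapted" "x \<in> chart_dom b" "x \<in> chart_dom b'"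
  shows "(transition b b' has_derivative id) (at (chart_map b x))"
proof -
  obtain c where c: "c \<in> A" "x \<in> chart_dom c" using cover by blast
  note chb = adapted_chart[OF assms(1)] and chc = charts[OF c(1)]
  obtain E where E: "coframe_map c x \<circ> E = id" using coframe_map_inverse[OF c] by metis
  have "transition b c (chart_map b x) = chart_map c x"
    using chart_inv_map[OF chb assms(3)] by (simp add: transition_def)
  then have "(transition c b' has_derivative coframe_map c x) (at (transition b c (chart_map b x)))"
    using adaptedD[OF assms(2) c(1) assms(4) c(2)] by simp
  from diff_chain_at[OF adapted_transition_inverse[OF assms(1,3) c E] this]
  have "(transition c b' \<circ> transition b c has_derivative id) (at (chart_map b x))"
    unfolding E .
  then show ?thesis
  proof (rule has_derivative_transform_within_open)
    show "open (chart_map b ` (chart_dom b \<inter> chart_dom c))"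
      by (rule open_chart_image[OF chb open_chart_dom[OF chc]])
    show "chart_map b x \<in> chart_map b ` (chart_dom b \<inter> chart_dom c)" using assms(3) c(2) by blast
  qed (simp add: transition_compose_eq[OF chb chc])
qed

text \<open>The coframe and its inverse are complex linear, so the transitions are holomorphic in
  both directions.\<close>

lemma hol_funs_adapted:
  assumes "open U"
  shows "hol_funs adapted U = hol_funs A U"
proof
  show "hol_funs adapted U \<subseteq> hol_funs A U"
  proof
    fix f assume "f \<in> hol_funs adapted U"
    then show "f \<in> hol_funs A U"
    proof (rule hol_funs_transfer[OF adapted_chart charts adapted_cover _ assms, rotated -1])
      fix b c j assume c: "b \<in> A" and b: "c \<in> adapted"
      show "holomorphic_several (\<lambda>p. transition b c p $ j) (chart_map b ` (chart_dom b \<inter> chart_dom c))"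
        using adaptedD[OF b c] coframe_map_linear[OF c]
        by (intro holomorphic_several_componentI) blast
    qed
  qed
  show "hol_funs A U \<subseteq> hol_funs adapted U"
  proof
    fix f assume "f \<in> hol_funs A U"
    then show "f \<in> hol_funs adapted U"
    proof (rule hol_funs_transfer[OF charts adapted_chart cover _ assms, rotated -1])
      fix b c j assume b: "b \<in> adapted" and c: "c \<in> A"
      show "holomorphic_several (\<lambda>p. transition b c p $ j) (chart_map b ` (chart_dom b \<inter> chart_dom c))"
      proof (rule holomorphic_several_componentI)
        fix p assume "p \<in> chart_map b ` (chart_dom b \<inter> chart_dom c)"
        then obtain x where x: "p = chart_map b x" "x \<in> chart_dom b" "x \<in> chart_dom c" by blast
        obtain E where "Vector_Spaces.linear (*s) (*s) E" "coframe_map c x \<circ> E = id"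
          using coframe_map_inverse[OF c x(3)] by metis
        then show "\<exists>D. (transition b c has_derivative D) (at p) \<and> Vector_Spaces.linear (*s) (*s) D"
          using adapted_transition_inverse[OF b x(2) c x(3)] x(1) by blast
      qed
    qed
  qed
qed

end

section \<open>Domains of holomorphy are holomorphically convex\<close>

locale translation_atlas = atlas A
  for A :: "('a::{t2_space,second_countable_topology}, 'n::finite) chart set" +
  assumes translation: "c \<in> A \<Longrightarrow> c' \<in> A \<Longrightarrow> x \<in> chart_dom c \<Longrightarrow> x \<in> chart_dom c' \<Longrightarrow>
    (transition c c' has_derivative id) (at (chart_map c x))"
begin

text \<open>The chart chosen by \<open>SOME\<close> is irrelevant, because the transitions are locally translations.\<close>

definition frame_deriv :: "complex ^ 'n \<Rightarrow> ('a \<Rightarrow> complex) \<Rightarrow> 'a \<Rightarrow> complex" where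
  "frame_deriv v f x = (let c = SOME c. c \<in> A \<and> x \<in> chart_dom c in
     dir_deriv v (f \<circ> chart_inv c) (chart_map c x))"

text \<open>A change of chart composes with a map whose derivative is the identity, so directions
  keep their coordinates.\<close>

lemma frame_deriv_eq:
  assumes "open U" "f \<in> hol_funs A U" "x \<in> U" "c \<in> A" "x \<in> chart_dom c"
  shows "frame_deriv v f x = dir_deriv v (f \<circ> chart_inv c) (chart_map c x)"
proof -
  define d where "d = (SOME c. c \<in> A \<and> x \<in> chart_dom c)"
  have d: "d \<in> A" "x \<in> chart_dom d"
    using someI_ex[of "\<lambda>c. c \<in> A \<and> x \<in> chart_dom c"] cover[of x] unfolding d_def by blast+
  note chc = charts[OF assms(4)] and chd = charts[OF d(1)]
  let ?S = "chart_map c ` (chart_dom c \<inter> chart_dom d)"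
  have "transition c d (chart_map c x) = chart_map d x"
    using chart_inv_map[OF chc assms(5)] by (simp add: transition_def)
  moreover have "chart_map d x \<in> chart_map d ` (chart_dom d \<inter> U)" using d(2) assms(3) by blast
  ultimately have "(f \<circ> chart_inv d has_derivative (\<lambda>v. dir_deriv v (f \<circ> chart_inv d) (chart_map d x)))
      (at (transition c d (chart_map c x)))"
    using holomorphic_several_has_derivative(1)[OF hol_funsD[OF assms(2) d(1)]] by simp
  from diff_chain_at[OF translation[OF assms(4) d(1) assms(5) d(2)] this]
  have "((f \<circ> chart_inv d) \<circ> transition c d has_derivative
      (\<lambda>v. dir_deriv v (f \<circ> chart_inv d) (chart_map d x))) (at (chart_map c x))"
    by (simp only: comp_id)
  then have "(f \<circ> chart_inv c has_derivative (\<lambda>v. dir_deriv v (f \<circ> chart_inv d) (chart_map d x)))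
      (at (chart_map c x))"
  proof (rule has_derivative_transform_within_open)
    show "open ?S" by (rule open_chart_image[OF chc open_chart_dom[OF chd]])
    show "chart_map c x \<in> ?S" using assms(5) d(2) by blast
    show "((f \<circ> chart_inv d) \<circ> transition c d) p = (f \<circ> chart_inv c) p" if "p \<in> ?S" for p
      using that unfolding chart_image_Int[OF chc] by (simp add: transition_def chart_inv_map[OF chd])
  qed
  then have "dir_deriv v (f \<circ> chart_inv c) (chart_map c x) = dir_deriv v (f \<circ> chart_inv d) (chart_map d x)"
    by (rule dir_deriv_eq)
  then show ?thesis by (simp add: frame_deriv_def d_def Let_def)
qed

lemma frame_deriv_chart:
  assumes "open U" "f \<in> hol_funs A U" "c \<in> A" "p \<in> chart_map c ` (chart_dom c \<inter> U)"
  shows "(frame_deriv v f \<circ> chart_inv c) p = dir_deriv v (f \<circ> chart_inv c) p"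
proof -
  obtain x where x: "x \<in> chart_dom c" "x \<in> U" "p = chart_map c x" using assms(4) by blast
  from frame_deriv_eq[OF assms(1,2) x(2) assms(3) x(1)] show ?thesis
    by (simp add: x(3) chart_inv_map[OF charts[OF assms(3)] x(1)])
qed

text \<open>This makes derivatives of \<open>f\<close> admissible test functions in the definition
  of the hull.\<close>

lemma hol_funs_frame_deriv:
  assumes "open U" "f \<in> hol_funs A U"
  shows "frame_deriv v f \<in> hol_funs A U"
  unfolding hol_funs_def
proof (intro CollectI ballI)
  fix c assume c: "c \<in> A"
  let ?S = "chart_map c ` (chart_dom c \<inter> U)"
  have S: "open ?S" by (rule open_chart_image[OF charts[OF c] assms(1)])
  from holomorphic_several_dir_deriv[OF S hol_funsD[OF assms(2) c]] S
  show "holomorphic_several (frame_deriv v f \<circ> chart_inv c) ?S"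
    by (rule holomorphic_several_cong) (rule frame_deriv_chart[OF assms c, symmetric])
qed

lemma hol_funs_frame_iterate:
  "open U \<Longrightarrow> f \<in> hol_funs A U \<Longrightarrow> (frame_deriv v ^^ k) f \<in> hol_funs A U"
  by (induction k) (auto intro: hol_funs_frame_deriv)

lemma frame_iterate_chart:
  assumes "open U" "f \<in> hol_funs A U" "c \<in> A" "p \<in> chart_map c ` (chart_dom c \<inter> U)"
  shows "((frame_deriv v ^^ k) f \<circ> chart_inv c) p = (dir_deriv v ^^ k) (f \<circ> chart_inv c) p"
  using assms(4)
proof (induction k arbitrary: p)
  case (Suc k)
  let ?S = "chart_map c ` (chart_dom c \<inter> U)"
  have S: "open ?S" by (rule open_chart_image[OF charts[OF assms(3)] assms(1)])
  have "((frame_deriv v ^^ Suc k) f \<circ> chart_inv c) p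
      = dir_deriv v ((frame_deriv v ^^ k) f \<circ> chart_inv c) p"
    using frame_deriv_chart[OF assms(1) hol_funs_frame_iterate[OF assms(1,2)] assms(3) Suc.prems]
    by simp
  also have "\<dots> = dir_deriv v ((dir_deriv v ^^ k) (f \<circ> chart_inv c)) p"
    by (rule dir_deriv_cong[OF holomorphic_several_iterate[OF S hol_funsD[OF assms(2,3)]] S
          Suc.IH[symmetric] Suc.prems])
  also have "\<dots> = (dir_deriv v ^^ Suc k) (f \<circ> chart_inv c) p"
    by (simp only: funpow.simps(2) o_apply[of _ "dir_deriv v ^^ k"])
  finally show ?case .
qed simp

lemma frame_iterate_eq:
  assumes "open U" "f \<in> hol_funs A U" "c \<in> A" "x \<in> chart_dom c" "x \<in> U"
  shows "(frame_deriv v ^^ k) f x = (dir_deriv v ^^ k) (f \<circ> chart_inv c) (chart_map c x)"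
  using frame_iterate_chart[OF assms(1-3), of "chart_map c x", where v = v and k = k] assms(4,5)
  by (simp add: chart_inv_map[OF charts[OF assms(3)]])

text \<open>Brings Taylor sums from coordinates back to the manifold; the identity, as derivative of
  the transitions, is complex linear.\<close>

lemma hol_funs_chart_ball:
  assumes "c \<in> A" "T \<subseteq> chart_map c ` chart_dom c" "holomorphic_several g T"
  shows "g \<circ> chart_map c \<in> hol_funs A (chart_inv c ` T)"
  unfolding hol_funs_def
proof (intro CollectI ballI)
  fix d assume d: "d \<in> A"
  let ?S = "chart_map d ` (chart_dom d \<inter> chart_inv c ` T)"
  note chc = charts[OF assms(1)] and chd = charts[OF d]
  have "transition d c ` ?S \<subseteq> T"
    using chart_inv_map[OF chd] chart_map_inv[OF chc] assms(2) by (auto simp: transition_def subset_iff)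
  moreover have "holomorphic_several (\<lambda>p. transition d c p $ j) ?S" for j
  proof (rule holomorphic_several_componentI)
    fix p assume "p \<in> ?S"
    then obtain x where x: "p = chart_map d x" "x \<in> chart_dom d" "x \<in> chart_inv c ` T" by blast
    then have "x \<in> chart_dom c" using chart_inv_in_dom[OF chc] assms(2) by blast
    from translation[OF d assms(1) x(2) this] x(1)
    show "\<exists>D. (transition d c has_derivative D) (at p) \<and> Vector_Spaces.linear (*s) (*s) D"
      by (intro exI[of _ id]) (simp add: vec_linear_iff)
  qed
  ultimately have "holomorphic_several (g \<circ> transition d c) ?S"
    by (intro holomorphic_several_compose[OF assms(3)])
  then show "holomorphic_several ((g \<circ> chart_map c) \<circ> chart_inv d) ?S"
    by (simp add: transition_def o_assoc)
qed

text \<open>In coordinates the part of \<open>K\<close> in the ball is compact, so a closed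
  \<epsilon>-neighbourhood of it fits into \<Omega>. The neighbourhood is compact too, and its image
  \<open>C\<close> is where functions will be bounded.\<close>

lemma uniform_chart_radius:
  fixes c :: "('a, 'n) chart" and K \<Omega> :: "'a set"
  assumes "is_chart c" "cball z r \<subseteq> chart_map c ` chart_dom c" "compact K" "K \<subseteq> \<Omega>" "open \<Omega>"
  obtains \<epsilon> C where "\<epsilon> > 0" "compact C" "C \<subseteq> \<Omega>"
    "\<And>y. y \<in> K \<Longrightarrow> y \<in> chart_inv c ` cball z r \<Longrightarrow>
      cball (chart_map c y) \<epsilon> \<subseteq> chart_map c ` (chart_dom c \<inter> \<Omega>) \<inter> chart_inv c -` C"
proof -
  define L where "L = cball z r \<inter> chart_inv c -` K"
  have "closed L"
    unfolding L_def by (rule continuous_closed_preimage[OF continuous_on_chart_inv[OF assms(1,2)]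
          closed_cball compact_imp_closed[OF assms(3)]])
  then have L: "compact L"
    unfolding compact_eq_bounded_closed L_def using bounded_Int bounded_cball by blast
  have "L \<subseteq> chart_map c ` (chart_dom c \<inter> \<Omega>)"
    unfolding chart_image_Int[OF assms(1)] L_def using assms(2,4) by blast
  then obtain \<epsilon> where \<epsilon>: "\<epsilon> > 0" "(\<Union>q\<in>L. cball q \<epsilon>) \<subseteq> chart_map c ` (chart_dom c \<inter> \<Omega>)"
    using compact_subset_open_imp_cball_epsilon_subset[OF L open_chart_image[OF assms(1,5)]] by blast
  define T where "T = (\<Union>q\<in>L. cball q \<epsilon>)"
  have T: "compact T" unfolding T_def by (rule compact_minkowski_sum_cball[OF L])
  show thesis
  proof
    show "compact (chart_inv c ` T)"
      using \<epsilon>(2) by (intro compact_chart_inv_image[OF assms(1) T]) (auto simp: T_def)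
    show "chart_inv c ` T \<subseteq> \<Omega>"
      using \<epsilon>(2) unfolding T_def chart_image_Int[OF assms(1)] by blast
    fix y assume y: "y \<in> K" "y \<in> chart_inv c ` cball z r"
    then obtain q where q: "q \<in> cball z r" "y = chart_inv c q" by blast
    then have "chart_map c y = q" using chart_map_inv[OF assms(1)] assms(2) by blast
    then have "chart_map c y \<in> L" using y(1) q by (simp add: L_def)
    then show "cball (chart_map c y) \<epsilon> \<subseteq>
        chart_map c ` (chart_dom c \<inter> \<Omega>) \<inter> chart_inv c -` chart_inv c ` T"
      using \<epsilon>(2) unfolding T_def by blast
  qed (rule \<epsilon>(1))
qed

lemma domain_of_holomorphy_imp_convex:
  assumes \<Omega>: "open \<Omega>" and compact: "relatively_compact_in \<Omega> UNIV"
    and doh: "domain_of_holomorphy A \<Omega>"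
  shows "holomorphically_convex A \<Omega>"
  unfolding holomorphically_convex_def
proof (intro allI impI, elim conjE)
  fix K assume K: "compact K" "K \<subseteq> \<Omega>" "K \<noteq> {}"
  have compact_cl: "compact (closure \<Omega>)" using compact unfolding relatively_compact_in_def by blast
  \<comment> \<open>The doubled radius ensures that a ball of radius at most \<open>r\<close> around
    a point of the \<open>r\<close>-ball still lies in the chart.\<close>
  have "\<forall>p. \<exists>c r. c \<in> A \<and> p \<in> chart_dom c \<and> r > 0 \<and> cball (chart_map c p) (2 * r) \<subseteq> chart_map c ` chart_dom c"
  proof
    fix p
    obtain c where c: "c \<in> A" "p \<in> chart_dom c" using cover by blast
    obtain r where "r > 0" "cball (chart_map c p) r \<subseteq> chart_map c ` (chart_dom c \<inter> UNIV)"
      using chart_cball[OF charts[OF c(1)] open_UNIV UNIV_I c(2)] .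
    with c show "\<exists>c r. c \<in> A \<and> p \<in> chart_dom c \<and> r > 0 \<and>
        cball (chart_map c p) (2 * r) \<subseteq> chart_map c ` chart_dom c"
      by (intro exI[of _ c] exI[of _ "r/2"]) simp
  qed
  then obtain c r where c: "\<And>p. c p \<in> A" "\<And>p. p \<in> chart_dom (c p)" and r: "\<And>p. r p > 0"
    "\<And>p. cball (chart_map (c p) p) (2 * r p) \<subseteq> chart_map (c p) ` chart_dom (c p)"
    by metis
  note ch = charts[OF c(1)]
  define z where "z p = chart_map (c p) p" for p
  have r1: "cball (z p) (r p) \<subseteq> chart_map (c p) ` chart_dom (c p)" for p
  proof -
    have "cball (z p) (r p) \<subseteq> cball (z p) (2 * r p)" using r(1)[of p] by (intro subset_cball) simp
    with r(2)[of p] show ?thesis unfolding z_def by blast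
  qed
  have ball_sub: "ball (z p) (r p) \<subseteq> chart_map (c p) ` chart_dom (c p)" for p
    using r1[of p] ball_subset_cball by blast
  define N where "N p = chart_inv (c p) ` ball (z p) (r p)" for p
  have N_eq: "N p = chart_dom (c p) \<inter> chart_map (c p) -` ball (z p) (r p)" for p
    unfolding N_def by (rule chart_inv_image[OF ch ball_sub])
  have open_N: "open (N p)" for p unfolding N_def by (rule open_chart_inv_image[OF ch open_ball ball_sub])
  have "p \<in> N p" for p unfolding N_eq using c(2) r(1) by (simp add: z_def)
  then have "closure \<Omega> \<subseteq> (\<Union>p\<in>closure \<Omega>. N p)" by blast
  then obtain I where I: "I \<subseteq> closure \<Omega>" "finite I" "closure \<Omega> \<subseteq> (\<Union>p\<in>I. N p)"
    by (rule compactE_image[OF compact_cl open_N])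
  have "\<forall>p. \<exists>\<epsilon> C. \<epsilon> > 0 \<and> compact C \<and> C \<subseteq> \<Omega> \<and> (\<forall>y. y \<in> K \<longrightarrow> y \<in> N p \<longrightarrow>
      cball (chart_map (c p) y) \<epsilon> \<subseteq> chart_map (c p) ` (chart_dom (c p) \<inter> \<Omega>) \<inter> chart_inv (c p) -` C)"
  proof
    fix p
    obtain \<epsilon> C where "\<epsilon> > 0" "compact C" "C \<subseteq> \<Omega>"
      and *: "\<And>y. y \<in> K \<Longrightarrow> y \<in> chart_inv (c p) ` cball (z p) (r p) \<Longrightarrow>
      cball (chart_map (c p) y) \<epsilon> \<subseteq> chart_map (c p) ` (chart_dom (c p) \<inter> \<Omega>) \<inter> chart_inv (c p) -` C"
      by (rule uniform_chart_radius[OF ch r1 K(1,2) \<Omega>]) (rule that)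
    moreover have N_sub: "y \<in> chart_inv (c p) ` cball (z p) (r p)" if "y \<in> N p" for y
      using that ball_subset_cball unfolding N_def by blast
    ultimately show "\<exists>\<epsilon> C. \<epsilon> > 0 \<and> compact C \<and> C \<subseteq> \<Omega> \<and> (\<forall>y. y \<in> K \<longrightarrow> y \<in> N p \<longrightarrow>
      cball (chart_map (c p) y) \<epsilon> \<subseteq> chart_map (c p) ` (chart_dom (c p) \<inter> \<Omega>) \<inter> chart_inv (c p) -` C)"
      by (intro exI[of _ \<epsilon>] exI[of _ C] conjI allI impI *)
  qed
  then obtain \<epsilon> C where \<epsilon>: "\<And>p. \<epsilon> p > 0" and C: "\<And>p. compact (C p)" "\<And>p. C p \<subseteq> \<Omega>"
    and near: "\<And>p y. y \<in> K \<Longrightarrow> y \<in> N p \<Longrightarrow> cball (chart_map (c p) y) (\<epsilon> p) \<subseteq>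
      chart_map (c p) ` (chart_dom (c p) \<inter> \<Omega>) \<inter> chart_inv (c p) -` C p"
    by metis
  \<comment> \<open>\<open>\<epsilon> p\<close> serves the Cauchy estimates on \<open>K\<close>, and
    \<open>r p\<close> keeps balls around hull points inside the chart; the 1 makes the set
    nonempty.\<close>
  define \<rho> where "\<rho> = Min (insert 1 ((\<lambda>p. min (\<epsilon> p) (r p)) ` I))"
  have fin: "finite (insert 1 ((\<lambda>p. min (\<epsilon> p) (r p)) ` I))" using I(2) by simp
  have \<rho>: "\<rho> > 0" unfolding \<rho>_def using \<epsilon> r(1) by (subst Min_gr_iff[OF fin]) auto
  have \<rho>_le: "\<rho> \<le> \<epsilon> p" "\<rho> \<le> r p" if "p \<in> I" for p
    using Min_le[OF fin, of "min (\<epsilon> p) (r p)"] that unfolding \<rho>_def by auto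
  define H where "H = hol_hull A \<Omega> K"
  have H\<Omega>: "H \<subseteq> \<Omega>" unfolding H_def hol_hull_def by blast

  \<comment> \<open>\<open>M\<close> may depend on \<open>f\<close>, but \<rho> does not, so all
    Taylor series at \<open>x\<close> converge on the same ball.\<close>
  have bound: "\<exists>M. \<forall>s v k. 0 < s \<longrightarrow> s < \<rho> \<longrightarrow> norm v \<le> s \<longrightarrow>
      cmod ((frame_deriv v ^^ k) f x) \<le> fact k * M * (s / \<rho>) ^ k"
    if f: "f \<in> hol_funs A \<Omega>" and x: "x \<in> H" for f x
  proof -
    have "compact (\<Union>p\<in>I. C p)" using I(2) C(1) by (intro compact_UN)
    moreover have "continuous_on (\<Union>p\<in>I. C p) f"
      by (rule continuous_on_subset[OF hol_funs_continuous_on[OF \<Omega> f]]) (use C(2) in blast)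
    ultimately have "bounded (f ` (\<Union>p\<in>I. C p))"
      by (intro compact_imp_bounded compact_continuous_image)
    then obtain M where M: "\<And>y. y \<in> (\<Union>p\<in>I. C p) \<Longrightarrow> cmod (f y) \<le> M"
      unfolding bounded_iff by (meson imageI)
    have "cmod ((frame_deriv v ^^ k) f x) \<le> fact k * M * (s / \<rho>) ^ k"
      if s: "0 < s" and v: "norm v \<le> s" for s v k
    proof -
      have at_K: "cmod ((frame_deriv v ^^ k) f y) \<le> fact k * M * (s / \<rho>) ^ k" if y: "y \<in> K" for y
      proof -
        have "y \<in> closure \<Omega>" using K(2) y closure_subset by blast
        then obtain p where p: "p \<in> I" "y \<in> N p" using I(3) by blast
        have "cball (chart_map (c p) y) \<rho> \<subseteq> cball (chart_map (c p) y) (\<epsilon> p)"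
          using \<rho>_le(1)[OF p(1)] by (rule subset_cball)
        then have sub: "cball (chart_map (c p) y) \<rho> \<subseteq>
            chart_map (c p) ` (chart_dom (c p) \<inter> \<Omega>) \<inter> chart_inv (c p) -` C p"
          using near[OF y p(2)] by (rule order_trans)
        have "cmod ((dir_deriv v ^^ k) (f \<circ> chart_inv (c p)) (chart_map (c p) y)) \<le>
            fact k * M * (s / \<rho>) ^ k"
        proof (rule iterate_bound[OF open_chart_image[OF ch \<Omega>] hol_funsD[OF f c(1)] _ \<rho> s v])
          show "cball (chart_map (c p) y) \<rho> \<subseteq> chart_map (c p) ` (chart_dom (c p) \<inter> \<Omega>)"
            using sub by blast
          show "cmod ((f \<circ> chart_inv (c p)) q) \<le> M" if "q \<in> cball (chart_map (c p) y) \<rho>" for q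
            using M[of "chart_inv (c p) q"] subsetD[OF sub that] p(1) by auto
        qed
        moreover have "y \<in> chart_dom (c p)" using p(2) unfolding N_eq by blast
        ultimately show ?thesis
          using frame_iterate_eq[OF \<Omega> f c(1)] K(2) y by (metis subsetD)
      qed
      \<comment> \<open>The hull inequality is applied to the derivative itself, for fixed
        \<open>v\<close> and \<open>k\<close>.\<close>
      have "cmod ((frame_deriv v ^^ k) f x) \<le> (SUP y\<in>K. cmod ((frame_deriv v ^^ k) f y))"
        using x hol_funs_frame_iterate[OF \<Omega> f] unfolding H_def hol_hull_def by blast
      also have "\<dots> \<le> fact k * M * (s / \<rho>) ^ k"
        using K(3) at_K by (rule cSUP_least)
      finally show ?thesis .
    qed
    then show ?thesis by blast
  qed

  \<comment> \<open>If the ball left \<Omega>, it would contain a frontier point by connectedness,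
    and the Taylor sums would extend every \<open>f\<close> to it.\<close>
  have key: "chart_inv (c p) ` ball (chart_map (c p) x) \<rho> \<subseteq> \<Omega>"
    if p: "p \<in> I" and x: "x \<in> H" "x \<in> N p" for p x
  proof (rule ccontr)
    define b where "b = c p"
    define q where "q = chart_map b x"
    note b = c(1)[of p, folded b_def] and chb = ch[of p, folded b_def]
    have xb: "x \<in> chart_dom b" "q \<in> ball (z p) (r p)"
      using x(2) unfolding N_eq by (auto simp: b_def q_def)
    have "ball q \<rho> \<subseteq> cball (z p) (2 * r p)"
    proof
      fix y assume "y \<in> ball q \<rho>"
      then show "y \<in> cball (z p) (2 * r p)"
        using xb(2) \<rho>_le(2)[OF p] dist_triangle[of "z p" y q] by simp
    qed
    then have ball_dom: "ball q \<rho> \<subseteq> chart_map b ` chart_dom b"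
      using r(2)[of p] unfolding z_def b_def by blast
    define U where "U = chart_inv b ` ball q \<rho>"
    have U: "open U" "connected U" "x \<in> U"
      unfolding U_def using open_chart_inv_image[OF chb open_ball ball_dom]
        connected_chart_inv_image[OF chb connected_ball ball_dom] chart_inv_map[OF chb xb(1)] \<rho>
      by (auto simp: q_def intro!: image_eqI[of _ _ "chart_map b x"])
    assume "\<not> chart_inv (c p) ` ball (chart_map (c p) x) \<rho> \<subseteq> \<Omega>"
    then have "U - \<Omega> \<noteq> {}" unfolding U_def q_def b_def by blast
    then have "U \<inter> frontier \<Omega> \<noteq> {}"
      using U(3) x(1) H\<Omega> by (intro connected_Int_frontier[OF U(2)]) auto
    then obtain y where y: "y \<in> frontier \<Omega>" "y \<in> U" by blast
    obtain e where e: "e > 0" "ball q e \<subseteq> chart_map b ` (chart_dom b \<inter> \<Omega>)"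
    proof -
      have "q \<in> chart_map b ` (chart_dom b \<inter> \<Omega>)" using xb(1) x(1) H\<Omega> unfolding q_def by blast
      then show thesis
        using open_chart_image[OF chb \<Omega>] that open_contains_ball by blast
    qed
    \<comment> \<open>Radius \<rho> keeps \<open>V\<close> inside \<open>U\<close>, and
      \<open>e/2\<close> is where the Taylor sum is known to equal \<open>f\<close>.\<close>
    define V where "V = chart_inv b ` ball q (min \<rho> (e/2))"
    have V_sub: "ball q (min \<rho> (e/2)) \<subseteq> ball q \<rho>" "ball q (min \<rho> (e/2)) \<subseteq> ball q (e/2)"
      by (intro subset_ball; simp)+
    have "open V"
      unfolding V_def by (rule open_chart_inv_image[OF chb open_ball order_trans[OF V_sub(1) ball_dom]])
    moreover have "V \<noteq> {}" unfolding V_def using \<rho> e(1) by simp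
    moreover have "V \<subseteq> U \<inter> \<Omega>"
    proof -
      have "ball q (e/2) \<subseteq> ball q e" using e(1) by (intro subset_ball) simp
      then have "chart_inv b ` ball q (e/2) \<subseteq> \<Omega>"
        using e(2) unfolding chart_image_Int[OF chb] by blast
      then show ?thesis using V_sub unfolding V_def U_def by blast
    qed
    moreover have "\<exists>g\<in>hol_funs A U. \<forall>x\<in>V. f x = g x" if f: "f \<in> hol_funs A \<Omega>" for f
    proof -
      obtain M where M: "\<And>s v k. 0 < s \<Longrightarrow> s < \<rho> \<Longrightarrow> norm v \<le> s \<Longrightarrow>
          cmod ((frame_deriv v ^^ k) f x) \<le> fact k * M * (s / \<rho>) ^ k"
        using bound[OF f x(1)] by blast
      have "cmod ((dir_deriv v ^^ k) (f \<circ> chart_inv b) q) \<le> fact k * M * (s / \<rho>) ^ k"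
        if "0 < s" "s < \<rho>" "norm v \<le> s" for s v k
        using M[OF that, of k] frame_iterate_eq[OF \<Omega> f b xb(1) subsetD[OF H\<Omega> x(1)], where v = v and k = k]
        by (simp only: q_def)
      from Taylor_extension[OF open_chart_image[OF chb \<Omega>] hol_funsD[OF f b] e(2,1) \<rho> this]
      obtain g where g: "holomorphic_several g (ball q \<rho>)"
        "\<And>z. z \<in> ball q (e/2) \<Longrightarrow> g z = (f \<circ> chart_inv b) z" by blast
      have "g \<circ> chart_map b \<in> hol_funs A U"
        unfolding U_def by (rule hol_funs_chart_ball[OF b ball_dom g(1)])
      moreover have "f y = (g \<circ> chart_map b) y" if "y \<in> V" for y
      proof -
        obtain w where w: "w \<in> ball q (min \<rho> (e/2))" "y = chart_inv b w"
          using \<open>y \<in> V\<close> unfolding V_def by blast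
        have "chart_map b y = w"
          using w V_sub(1) ball_dom chart_map_inv[OF chb, of w] by blast
        moreover have "g w = f y" using g(2)[OF subsetD[OF V_sub(2) w(1)]] w(2) by simp
        ultimately show ?thesis by simp
      qed
      ultimately show ?thesis by blast
    qed
    ultimately show False
      using doh y U(1,2) unfolding domain_of_holomorphy_def by blast
  qed

  have "closure H \<subseteq> \<Omega>"
  proof
    fix x assume x: "x \<in> closure H"
    then have "x \<in> closure \<Omega>" using closure_mono[OF H\<Omega>] by blast
    then obtain p where p: "p \<in> I" "x \<in> N p" using I(3) by blast
    define q where "q = chart_map (c p) x"
    have x_dom: "x \<in> chart_dom (c p)" and q: "q \<in> ball (z p) (r p)"
      using p(2) unfolding N_eq by (auto simp: q_def)
    \<comment> \<open>A hull point is sought so close to \<open>x\<close> that its \<rho>-ball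
      contains \<open>x\<close>; the second ball keeps it in \<open>N p\<close>, where
      \<open>key\<close> applies.\<close>
    let ?T = "ball q \<rho> \<inter> ball (z p) (r p)"
    have T: "?T \<subseteq> chart_map (c p) ` chart_dom (c p)" using ball_sub by blast
    have "open (chart_inv (c p) ` ?T)"
      by (rule open_chart_inv_image[OF ch open_Int[OF open_ball open_ball] T])
    moreover have "x \<in> chart_inv (c p) ` ?T"
      using q \<rho> chart_inv_map[OF ch x_dom] by (intro image_eqI[of _ _ q]) (auto simp: q_def)
    ultimately have "chart_inv (c p) ` ?T \<inter> H \<noteq> {}"
      using x open_Int_closure_eq_empty[of "chart_inv (c p) ` ?T" H] by blast
    then obtain w where w: "w \<in> ?T" "chart_inv (c p) w \<in> H" by blast
    have "chart_map (c p) (chart_inv (c p) w) = w"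
      using chart_map_inv[OF ch] T w(1) by blast
    moreover have "chart_inv (c p) w \<in> N p" using w(1) unfolding N_def by blast
    ultimately have "chart_inv (c p) ` ball w \<rho> \<subseteq> \<Omega>" using key[OF p(1) w(2)] by simp
    moreover have "q \<in> ball w \<rho>" using w(1) by (simp add: dist_commute)
    ultimately show "x \<in> \<Omega>" using chart_inv_map[OF ch x_dom] unfolding q_def by (metis image_subset_iff)
  qed
  moreover have "compact (closure H)"
    using compact_cl closure_mono[OF H\<Omega>] closed_closure by (metis compact_Int_closed inf.absorb_iff2)
  ultimately show "relatively_compact_in (hol_hull A \<Omega> K) \<Omega>"
    unfolding relatively_compact_in_def H_def by blast
qed

end

theorem corollary1p11:
  fixes A :: "('a::{t2_space,second_countable_topology}, 'n::finite) chart set"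
    and \<Omega> :: "'a set"
  assumes "cond_A A"
    and "subdomain \<Omega>"
    and "relatively_compact_in \<Omega> UNIV"
  shows "domain_of_holomorphy A \<Omega> \<longleftrightarrow> holomorphically_convex A \<Omega>"
proof -
  obtain \<omega> where \<omega>: "holomorphic_coframe A \<omega>" "\<And>j. closed_form1 A (\<omega> j)"
    and A: "complex_manifold A"
    using assms(1) unfolding cond_A_def by blast
  have \<Omega>: "open \<Omega>" using assms(2) unfolding subdomain_def by blast
  interpret atlas A
    using A unfolding complex_manifold_def by unfold_locales blast+
  interpret closed_coframe A \<omega>
    using A \<omega> by unfold_locales
  interpret adapted: translation_atlas adapted
    using adapted_chart adapted_cover adapted_translation by unfold_locales
  have convex_eq: "holomorphically_convex adapted \<Omega> \<longleftrightarrow> holomorphically_convex A \<Omega>"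
    unfolding holomorphically_convex_def hol_hull_def hol_funs_adapted[OF \<Omega>] ..
  \<comment> \<open>\<open>hol_funs_adapted\<close> requires open sets; for \<open>U\<close> this
    comes from the conjunct \<open>open U\<close>, which \<open>conj_cong\<close> makes
    available.\<close>
  have doh_eq: "domain_of_holomorphy adapted \<Omega> \<longleftrightarrow> domain_of_holomorphy A \<Omega>"
    unfolding domain_of_holomorphy_def
    by (simp add: hol_funs_adapted[OF \<Omega>] hol_funs_adapted cong: conj_cong)
  show ?thesis
    using adapted.domain_of_holomorphy_imp_convex[OF \<Omega> assms(3)]
      convex_imp_domain_of_holomorphy[OF \<Omega>] convex_eq doh_eq by blast
qed

end
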